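(* For any positive integers $m$ and $n$, $$N(P_m\times P_n)\le\sum_{k=1}^{n}(N_{m,k}-N'_{m,k})\cdot(n-k+1),$$ where equality holds when $m=3,4$.
   Context: All graphs are finite and simple; $K_m$, $P_n$ are the complete graph and path of order $m$, $n$. The Cartesian product $G\times H$ has vertex set $V(G)\times V(H)$ and edges $(u_1,v_1)(u_2,v_2)$ with either $u_1u_2\in E(G)$, $v_1=v_2$, or $v_1v_2\in E(H)$, $u_1=u_2$. A connected set of $G$ is a nonempty $C\subseteq V(G)$ with $G[C]$ connected; $\mathcal C(G)$ is the set of all connected sets, $N(G)=|\mathcal C(G)|$, and $c(G)$ is the number of connected components of $G$. Labelling. $K_m\times P_n$ and $P_m\times P_n$ have the same vertex set $\{v_{i,j}:1\le i\le m,\ 1\le j\le n\}$, where $i$ is the coordinate in $K_m$ (resp. $P_m$, with $v_{i_1,j}v_{i_2,j}$ an edge of $P_m\times P_n$ iff $|i_1-i_2|=1$) and $j$ the coordinate in $P_n$. Thus $\mathcal C(P_m\times P_n)\subseteq\mathcal C(K_m\times P_n)$. The $j$-th column is $I_j=\{v_{i,j}:1\le i\le m\}$. For $S\subseteq I_j$ with $j\ge2$, write $S^{-}\subseteq I_{j-1}$ for the set of vertices of $I_{j-1}$ adjacent to vertices of $S$ (i.e. $S$ shifted to column $j-1$). For $k\le n$, $K_m\times P_k$ and $P_m\times P_k$ are regarded as the subgraphs induced by the first $k$ columns. Counts. $\mathcal C_{m,n}$ is the set of connected sets of $K_m\times P_n$ containing at least one vertex in each column, and $N_{m,n}=|\mathcal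 C_{m,n}|$. $\mathcal C'_{m,n}$ is the set of elements of $\mathcal C(K_m\times P_n)\setminus\mathcal C(P_m\times P_n)$ containing at least one vertex in each column. For nonempty $X\subseteq V(K_m\times P_n)$, $N(K_m\times P_n;X)$ (resp. $N'(K_m\times P_n;X)$) is the number of $C\in\mathcal C_{m,n}$ (resp. $C\in\mathcal C'_{m,n}$) such that $C\cap I_i=X\cap I_i$ whenever $X\cap I_i\ne\emptyset$. Definition of $N'_{m,n}$. It is the lower bound for $|\mathcal C'_{m,n}|$ given by $N'_{m,n}=\sum_{\emptyset\ne S\subseteq I_n}L_n(S)$, where the numbers $L_n(S)$ (for $\emptyset\neq S\subseteq I_n$) and $L_n(S,T)$ (for $n\ge2$, $S\subseteq I_n$, $T\subseteq I_{n-1}$, $T\cap S^{-}\ne\emptyset$) are defined recursively as follows. (Base) $L_n(S)=N'(K_m\times P_n;S)$ for $n=1,2$, and $L_2(S,T)=N'(K_m\times P_2;S\cup T)$. (Step 1) For $n\ge3$, $L_n(S)=\sum_{T}L_n(S,T)$ over all $T\subseteq I_{n-1}$ with $T\cap S^{-}\neq\emptyset$. (Step 2) For $n\ge3$, with $G=P_m\times P_n$: - if some component of $G[S]$ is also a component of $G[S\cup T]$, then $L_n(S,T)=N(K_m\times P_{n-1};T)$; - if no component of $G[S]$ is a component of $G[S\cup T]$ and $c(G[S\cup T])=c(G[T])$, then $L_n(S,T)=L_{n-1}(T)$; - if no component of $G[S]$ is a component of $G[S\cup T]$ and $c(G[S\cup T])<c(G[T])$, then $L_n(S,T)=\sum_{X}\ell(X)$,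 the sum being over all $X\subseteq I_{n-2}$ with $X\cap T^{-}\neq\emptyset$ that satisfy one of (i), (ii), (iii): (i) some component of $G[S\cup T]$ is also a component of $G[S\cup T\cup X]$; then $\ell(X)=N(K_m\times P_{n-2};X)$. (ii) no component of $G[S\cup T]$ is a component of $G[S\cup T\cup X]$, and $c(G[S\cup T\cup X])=c(G[X])$; then $\ell(X)=L_{n-2}(X)$. (iii) no component of $G[S\cup T]$ is a component of $G[S\cup T\cup X]$, $c(G[S\cup T\cup X])<c(G[X])$, and for any two indices $i_1\le i_2$ one has $l_{i_1}=l_{i_2}$ if and only if $l_{i_3}=l_{i_1}$ for all $i_3$ with $i_1\le i_3\le i_2$. Here $R_1,\dots,R_r$ are the components of $G[X]$, ordered so that $k_s<k_t$ for all $v_{k_s,n-2}\in R_s$, $v_{k_t,n-2}\in R_t$ with $s<t$, and $l_i$ (resp. $\overline l_i$) is the smallest (resp. largest) integer $q$ such that $v_{q,n-2}$ lies in the component of $G[S\cup T\cup X]$ containing $R_i$. Then $\ell(X)=L_{n-1}(J,X)$ with $J=\{v_{j,n-1}: l_i\le j\le\overline l_i \text{ for some } i\in\{1,\dots,r\}\}$. *)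

theory Defs
  imports "Graph_Theory.Graph_Theory"
begin

text \<open>
  A finite simple graph is a \<open>pair_graph\<close>: finite vertex set, symmetric irreflexive arc relation.
\<close>

definition complete_graph :: "nat \<Rightarrow> nat pair_pre_digraph" where
  "complete_graph m =
     \<lparr> pverts = {1..m}, parcs = {(u, v). u \<in> {1..m} \<and> v \<in> {1..m} \<and> u \<noteq> v} \<rparr>"

definition path_graph :: "nat \<Rightarrow> nat pair_pre_digraph" where
  "path_graph n =
     \<lparr> pverts = {1..n},
       parcs = {(u, v). u \<in> {1..n} \<and> v \<in> {1..n} \<and> (v = u + 1 \<or> u = v + 1)} \<rparr>"

definition cart_prod ::
    "'a pair_pre_digraph \<Rightarrow> 'b pair_pre_digraph \<Rightarrow> ('a \<times> 'b) pair_pre_digraph"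
  where
  "cart_prod G H =
     \<lparr> pverts = pverts G \<times> pverts H,
       parcs = {((u1, v1), (u2, v2)).
                  (u1, u2) \<in> parcs G \<and> v1 = v2 \<and> v1 \<in> pverts H \<or>
                  (v1, v2) \<in> parcs H \<and> u1 = u2 \<and> u1 \<in> pverts G} \<rparr>"

lemma pair_graph_complete_graph: "pair_graph (complete_graph m)"
proof -
  have "finite (parcs (complete_graph m))"
    by (rule finite_subset[of _ "{1..m} \<times> {1..m}"]) (auto simp: complete_graph_def)
  then show ?thesis
    by unfold_locales (auto simp: complete_graph_def symmetric_def intro!: symI)
qed

lemma pair_graph_path_graph: "pair_graph (path_graph n)"
proof -
  have "finite (parcs (path_graph n))"
    by (rule finite_subset[of _ "{1..n} \<times> {1..n}"]) (auto simp: path_graph_def)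
  then show ?thesis
    by unfold_locales (auto simp: path_graph_def symmetric_def intro!: symI)
qed

lemma pair_graph_cart_prod:
  assumes "pair_graph G" "pair_graph H"
  shows "pair_graph (cart_prod G H)"
proof -
  interpret G: pair_graph G by fact
  interpret H: pair_graph H by fact
  have sub: "parcs (cart_prod G H) \<subseteq> pverts (cart_prod G H) \<times> pverts (cart_prod G H)"
    by (auto simp: cart_prod_def dest: G.wellformed' H.wellformed')
  have fin: "finite (pverts (cart_prod G H))"
    by (simp add: cart_prod_def G.pair_finite_verts H.pair_finite_verts)
  have "finite (parcs (cart_prod G H))"
    using finite_subset[OF sub] fin by blast
  moreover have "symmetric (with_proj (cart_prod G H))"
    using G.pair_sym_arcs H.pair_sym_arcs
    by (auto simp: symmetric_def cart_prod_def intro!: symI dest: symD)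
  moreover have "fst e \<noteq> snd e" if "e \<in> parcs (cart_prod G H)" for e
    using that G.pair_no_loops H.pair_no_loops by (fastforce simp: cart_prod_def)
  ultimately show ?thesis
    using sub fin by unfold_locales auto
qed

definition connected_sets :: "('a, 'b) pre_digraph \<Rightarrow> 'a set set" where
  "connected_sets G = {C. C \<noteq> {} \<and> C \<subseteq> verts G \<and> connected (G \<restriction> C)}"

definition num_connected_sets :: "('a, 'b) pre_digraph \<Rightarrow> nat" where
  "num_connected_sets G = card (connected_sets G)"

text \<open>
  Components are represented by their vertex sets. This loses nothing, since all graphs whose
  components are compared below are induced subgraphs of one and the same graph.
\<close>

definition components :: "('a, 'b) pre_digraph \<Rightarrow> 'a set set" where
  "components G =
     {D \<in> connected_sets G. \<forall>D' \<in> connected_sets G. D \<subseteq> D' \<longrightarrow> D' = D}"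

definition num_components :: "('a, 'b) pre_digraph \<Rightarrow> nat" where
  "num_components G = card (components G)"

text \<open>The vertex \<open>v\<^sub>i\<^sub>,\<^sub>j\<close> is the pair \<open>(i, j)\<close>.\<close>

abbreviation KP :: "nat \<Rightarrow> nat \<Rightarrow> (nat \<times> nat, (nat \<times> nat) \<times> (nat \<times> nat)) pre_digraph" where
  "KP m n \<equiv> with_proj (cart_prod (complete_graph m) (path_graph n))"

abbreviation PP :: "nat \<Rightarrow> nat \<Rightarrow> (nat \<times> nat, (nat \<times> nat) \<times> (nat \<times> nat)) pre_digraph" where
  "PP m n \<equiv> with_proj (cart_prod (path_graph m) (path_graph n))"

definition column :: "nat \<Rightarrow> nat \<Rightarrow> (nat \<times> nat) set" where
  "column m j = {(i, j) | i. 1 \<le> i \<and> i \<le> m}"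

text \<open>\<open>prev_col m j S\<close> is \<open>S\<^sup>-\<close> for \<open>S \<subseteq> column m j\<close>.\<close>

definition prev_col :: "nat \<Rightarrow> nat \<Rightarrow> (nat \<times> nat) set \<Rightarrow> (nat \<times> nat) set" where
  "prev_col m j S = {v \<in> column m (j - 1). \<exists>s \<in> S. v \<rightarrow>\<^bsub>KP m j\<^esub> s}"

definition full_sets :: "nat \<Rightarrow> nat \<Rightarrow> (nat \<times> nat) set set" where
  "full_sets m n =
     {C \<in> connected_sets (KP m n). \<forall>j \<in> {1..n}. C \<inter> column m j \<noteq> {}}"

definition full_sets' :: "nat \<Rightarrow> nat \<Rightarrow> (nat \<times> nat) set set" where
  "full_sets' m n =
     {C \<in> connected_sets (KP m n) - connected_sets (PP m n).
        \<forall>j \<in> {1..n}. C \<inter> column m j \<noteq> {}}"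

definition N_full :: "nat \<Rightarrow> nat \<Rightarrow> nat" where
  "N_full m n = card (full_sets m n)"

definition agrees :: "nat \<Rightarrow> nat \<Rightarrow> (nat \<times> nat) set \<Rightarrow> (nat \<times> nat) set \<Rightarrow> bool" where
  "agrees m n X C \<longleftrightarrow>
     (\<forall>i \<in> {1..n}. X \<inter> column m i \<noteq> {} \<longrightarrow> C \<inter> column m i = X \<inter> column m i)"

text \<open>\<open>N_fix m n X\<close> and \<open>N_fix' m n X\<close> are \<open>N(K\<^sub>m \<times> P\<^sub>n; X)\<close> and \<open>N'(K\<^sub>m \<times> P\<^sub>n; X)\<close>.\<close>

definition N_fix :: "nat \<Rightarrow> nat \<Rightarrow> (nat \<times> nat) set \<Rightarrow> nat" where
  "N_fix m n X = card {C \<in> full_sets m n. agrees m n X C}"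

definition N_fix' :: "nat \<Rightarrow> nat \<Rightarrow> (nat \<times> nat) set \<Rightarrow> nat" where
  "N_fix' m n X = card {C \<in> full_sets' m n. agrees m n X C}"

text \<open>
  The components \<open>R\<^sub>1, \<dots>, R\<^sub>r\<close> of \<open>G[X]\<close>, for \<open>X\<close> inside one column, listed from low to high
  row index. Positions in the list start at 0.
\<close>

definition ordered_components ::
    "(nat \<times> nat, 'b) pre_digraph \<Rightarrow> (nat \<times> nat) set \<Rightarrow> (nat \<times> nat) set list" where
  "ordered_components G X =
     (THE Rs. set Rs = components (G \<restriction> X) \<and>
        sorted_wrt (\<lambda>A B. \<forall>a \<in> A. \<forall>b \<in> B. fst a < fst b) Rs)"

text \<open>
  The row indices occurring in column \<open>j\<close> of the component of \<open>G[Y]\<close> that contains \<open>R\<close>;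
  \<open>l\<^sub>i\<close> and its overlined variant are the minimum and maximum of this set for \<open>R = R\<^sub>i\<close>,
  \<open>j = n - 2\<close> and \<open>Y = S \<union> T \<union> X\<close>.
\<close>

definition comp_rows ::
    "(nat \<times> nat, 'b) pre_digraph \<Rightarrow> (nat \<times> nat) set \<Rightarrow> nat \<Rightarrow> (nat \<times> nat) set \<Rightarrow> nat set"
  where
  "comp_rows G Y j R = {q. \<exists>D \<in> components (G \<restriction> Y). R \<subseteq> D \<and> (q, j) \<in> D}"

definition l_low ::
    "(nat \<times> nat, 'b) pre_digraph \<Rightarrow> (nat \<times> nat) set \<Rightarrow> nat \<Rightarrow> (nat \<times> nat) set \<Rightarrow> nat"
  where
  "l_low G Y j R = Min (comp_rows G Y j R)"

definition l_high ::
    "(nat \<times> nat, 'b) pre_digraph \<Rightarrow> (nat \<times> nat) set \<Rightarrow> nat \<Rightarrow> (nat \<times> nat) set \<Rightarrow> nat"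
  where
  "l_high G Y j R = Max (comp_rows G Y j R)"

definition consecutive_groups ::
    "(nat \<times> nat, 'b) pre_digraph \<Rightarrow> (nat \<times> nat) set \<Rightarrow> nat \<Rightarrow> (nat \<times> nat) set \<Rightarrow> bool"
  where
  "consecutive_groups G Y j X \<longleftrightarrow>
     (let Rs = ordered_components G X; l = (\<lambda>i. l_low G Y j (Rs ! i)) in
      \<forall>i1 i2. i1 \<le> i2 \<and> i2 < length Rs \<longrightarrow>
        (l i1 = l i2 \<longleftrightarrow> (\<forall>i3. i1 \<le> i3 \<and> i3 \<le> i2 \<longrightarrow> l i3 = l i1)))"

text \<open>The set \<open>J\<close> in column \<open>j + 1\<close>, where \<open>X\<close> lies in column \<open>j\<close>.\<close>

definition hull_set ::
    "(nat \<times> nat, 'b) pre_digraph \<Rightarrow> (nat \<times> nat) set \<Rightarrow> nat \<Rightarrow> (nat \<times> nat) set \<Rightarrow> (nat \<times> nat) set"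
  where
  "hull_set G Y j X =
     {(q, j + 1) | q. \<exists>R \<in> components (G \<restriction> X). l_low G Y j R \<le> q \<and> q \<le> l_high G Y j R}"

text \<open>
  \<open>L1 m n S\<close> and \<open>L2 m n S T\<close> are \<open>L\<^sub>n(S)\<close> and \<open>L\<^sub>n(S, T)\<close>; the intended range is \<open>n \<ge> 1\<close> for
  the former and \<open>n \<ge> 2\<close> for the latter. A set \<open>X\<close> that satisfies none of the three conditions
  contributes 0.
\<close>

function L1 :: "nat \<Rightarrow> nat \<Rightarrow> (nat \<times> nat) set \<Rightarrow> nat"
  and L2 :: "nat \<Rightarrow> nat \<Rightarrow> (nat \<times> nat) set \<Rightarrow> (nat \<times> nat) set \<Rightarrow> nat"
  where
  "L1 m n S =
     (if n \<le> 2 then N_fix' m n S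
      else \<Sum>T | T \<subseteq> column m (n - 1) \<and> T \<inter> prev_col m n S \<noteq> {}. L2 m n S T)"
| "L2 m n S T =
     (if n \<le> 2 then N_fix' m n (S \<union> T)
      else if components (PP m n \<restriction> S) \<inter> components (PP m n \<restriction> (S \<union> T)) \<noteq> {}
        then N_fix m (n - 1) T
      else if num_components (PP m n \<restriction> (S \<union> T)) = num_components (PP m n \<restriction> T)
        then L1 m (n - 1) T
      else if num_components (PP m n \<restriction> (S \<union> T)) < num_components (PP m n \<restriction> T)
        then \<Sum>X | X \<subseteq> column m (n - 2) \<and> X \<inter> prev_col m (n - 1) T \<noteq> {}.
          (if components (PP m n \<restriction> (S \<union> T)) \<inter> components (PP m n \<restriction> (S \<union> T \<union> X)) \<noteq> {}
             then N_fix m (n - 2) X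
           else if num_components (PP m n \<restriction> (S \<union> T \<union> X)) = num_components (PP m n \<restriction> X)
             then L1 m (n - 2) X
           else if num_components (PP m n \<restriction> (S \<union> T \<union> X)) < num_components (PP m n \<restriction> X)
                \<and> consecutive_groups (PP m n) (S \<union> T \<union> X) (n - 2) X
             then L2 m (n - 1) (hull_set (PP m n) (S \<union> T \<union> X) (n - 2) X) X
           else 0)
      else 0)"
  by pat_completeness auto
termination
  by (relation "measure (\<lambda>x. case x of Inl (m, n, S) \<Rightarrow> 2 * n + 1 | Inr (m, n, S, T) \<Rightarrow> 2 * n)")
    auto

text \<open>The unconditional equations loop when used as rewrite rules.\<close>

declare L1.simps [simp del] L2.simps [simp del]

definition N_low :: "nat \<Rightarrow> nat \<Rightarrow> nat" where
  "N_low m n = (\<Sum>S | S \<noteq> {} \<and> S \<subseteq> column m n. L1 m n S)"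

end

theory Submission
  imports Defs
begin

text \<open>
  A set that meets every column of \<open>K\<^sub>m \<times> P\<^sub>n\<close> is connected there iff any two consecutive columns share
  a row, so such sets can be built column by column. Whether \<open>C \<union> W\<close> is connected in the grid, for
  \<open>W\<close> lying above the last column \<open>X\<close> of \<open>C\<close>, depends on \<open>W\<close> only through the relation that
  reachability in \<open>W \<union> X\<close> induces on \<open>X\<close>, unless \<open>W\<close> has a component cut off from \<open>X\<close>. Each clause in
  the recursion for \<open>L\<close> replaces \<open>W\<close> by something simpler inducing the same relation: by the empty
  set if \<open>W\<close> merges no components of \<open>X\<close>, and by the hull \<open>J\<close> if the classes of components merged by
  \<open>W\<close> are intervals. The only sets lost are those with classes that are not intervals, which needs
  three components in one column, hence \<open>m \<ge> 5\<close>.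
\<close>

section \<open>Reachability inside a vertex set\<close>

text \<open>Bounding the sets that are disconnected in the grid from below bounds the connected ones
  from above, so the task is to compare the recursion with an exact count. That count has to carry a
  context: \<open>defective m k X W\<close> fixes the last column \<open>X\<close> and judges
  connectedness together with the part \<open>W\<close> already chosen to its right. In these terms
  \<open>L1 m n S\<close> estimates the count for column \<open>S\<close> with empty context, and
  \<open>L2 m n S T\<close> the count for column \<open>T\<close> with context \<open>S\<close>. The
  obstacle is that the context grows with every column that is removed. The recursion closes because
  a context never exceeds two columns, \<open>S \<union> T\<close>, before nothing or the single
  column \<open>J\<close> takes its place. A single column joins two components of \<open>X\<close>
  only by running through all rows between them, and so it also joins every component in between,
  whereas two columns can bypass such a component. Hence no choice of \<open>J\<close> can express
  classes that are not intervals.\<close>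

definition conn :: "'a rel \<Rightarrow> 'a set \<Rightarrow> bool" where
  "conn r Y \<longleftrightarrow> Y \<noteq> {} \<and> (\<forall>u\<in>Y. \<forall>v\<in>Y. (u, v) \<in> rtrancl_on Y r)"

text \<open>Equivalence classes rather than maximal connected sets: taking the image under a larger
  reachability relation then maps components to components, which is how merging is counted.\<close>

definition comps :: "'a rel \<Rightarrow> 'a set \<Rightarrow> 'a set set" where
  "comps r Y = Y // rtrancl_on Y r"

lemma rtrancl_on_cong:
  assumes "\<And>u v. u \<in> Y \<Longrightarrow> v \<in> Y \<Longrightarrow> (u, v) \<in> r \<longleftrightarrow> (u, v) \<in> s"
  shows "rtrancl_on Y r = rtrancl_on Y s"
proof -
  have "(a, b) \<in> rtrancl_on Y s"
    if "(a, b) \<in> rtrancl_on Y r" and "\<And>u v. u \<in> Y \<Longrightarrow> v \<in> Y \<Longrightarrow> (u, v) \<in> r \<longleftrightarrow> (u, v) \<in> s"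
    for a b r s
    using that by (induct rule: rtrancl_on_induct) (auto intro: rtrancl_on_into_rtrancl_on)
  with assms show ?thesis by (metis (no_types, lifting) subrelI subset_antisym)
qed

lemma rtrancl_on_subset: "A \<subseteq> B \<Longrightarrow> (a, b) \<in> rtrancl_on A r \<Longrightarrow> (a, b) \<in> rtrancl_on B r"
  by (rule rtrancl_on_mono[OF subset_refl])

lemma rtrancl_on_edge: "u \<in> Y \<Longrightarrow> v \<in> Y \<Longrightarrow> (u, v) \<in> r \<Longrightarrow> (u, v) \<in> rtrancl_on Y r"
  by (auto intro: rtrancl_on_into_rtrancl_on)

lemma rtrancl_on_symD: "sym r \<Longrightarrow> (u, v) \<in> rtrancl_on Y r \<Longrightarrow> (v, u) \<in> rtrancl_on Y r"
  using rtrancl_on_sym symD by metis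

lemma equiv_rtrancl_on: "sym r \<Longrightarrow> equiv Y (rtrancl_on Y r)"
  by (intro equivI refl_onI rtrancl_on_sym transI) (auto intro: rtrancl_on_trans dest: in_rtrancl_on_in_F)

text \<open>Arcs leaving \<open>C\<close> vanish in the induced subgraph, so agreement on
  \<open>C\<close> suffices and \<open>r\<close> may live on an unbounded vertex set. Symmetry of
  \<open>r\<close> absorbs the symmetric closure in the library's notion of connectedness.\<close>

lemma connected_induce_iff_conn:
  assumes "sym r" "\<And>u v. u \<in> C \<Longrightarrow> v \<in> C \<Longrightarrow> (u, v) \<in> arcs_ends G \<longleftrightarrow> (u, v) \<in> r"
  shows "connected (G \<restriction> C) \<longleftrightarrow> conn r C"
proof -
  have "arcs_ends (G \<restriction> C) = {(u, v). u \<in> C \<and> v \<in> C \<and> (u, v) \<in> arcs_ends G}"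
    by (auto simp: arcs_ends_conv induce_subgraph_def)
  then have "rtrancl_on C ((arcs_ends (G \<restriction> C))\<^sup>s) = rtrancl_on C r"
    using assms by (intro rtrancl_on_cong) (auto simp: symcl_def sym_def)
  then show ?thesis
    by (simp add: connected_conv conn_def)
qed

text \<open>A walk in \<open>Y\<close> that starts at \<open>x\<close> visits only vertices
  reachable from \<open>x\<close>, so it is a walk inside the class already.\<close>

lemma conn_rtrancl_on_Image:
  assumes "sym r" "x \<in> Y"
  shows "conn r (rtrancl_on Y r `` {x})"
proof -
  let ?D = "rtrancl_on Y r `` {x}"
  have *: "(x, v) \<in> rtrancl_on ?D r" if "(x, v) \<in> rtrancl_on Y r" for v
    using that
  proof (induct rule: rtrancl_on_induct)
    case base
    then show ?case by auto
  next
    case (step y z)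
    then show ?case by (blast intro: rtrancl_on_into_rtrancl_on)
  qed
  show ?thesis
    unfolding conn_def
    using * assms by (blast intro: rtrancl_on_trans rtrancl_on_symD)
qed

text \<open>A class absorbs every connected set through one of its points, hence is maximal.
  Conversely a maximal connected set lies in the class of any of its points, and that class is
  itself connected.\<close>

lemma comps_eq_maximal_conn:
  assumes "sym r"
  shows "comps r Y
    = {D. D \<subseteq> Y \<and> conn r D \<and> (\<forall>D'. D' \<subseteq> Y \<and> conn r D' \<and> D \<subseteq> D' \<longrightarrow> D' = D)}" (is "_ = ?M")
proof (intro set_eqI iffI)
  fix D assume "D \<in> comps r Y"
  then obtain x where x: "x \<in> Y" and D: "D = rtrancl_on Y r `` {x}"
    by (auto simp: comps_def quotient_def)
  have "D' = D" if "D' \<subseteq> Y" "conn r D'" "D \<subseteq> D'" for D'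
  proof -
    have "x \<in> D'" using that x D by auto
    then have "D' \<subseteq> D"
      using that rtrancl_on_subset[of D' Y] unfolding D conn_def by blast
    with that show ?thesis by blast
  qed
  then show "D \<in> ?M"
    using conn_rtrancl_on_Image[OF assms x] D by (auto dest: in_rtrancl_on_in_F)
next
  fix D assume D: "D \<in> ?M"
  then obtain x where x: "x \<in> D" by (auto simp: conn_def)
  with D have "D \<subseteq> rtrancl_on Y r `` {x}"
    using rtrancl_on_subset[of D Y] by (auto simp: conn_def)
  moreover have "conn r (rtrancl_on Y r `` {x})"
    using x D conn_rtrancl_on_Image[OF assms] by blast
  moreover have "rtrancl_on Y r `` {x} \<subseteq> Y"
    by (auto dest: in_rtrancl_on_in_F)
  ultimately have "D = rtrancl_on Y r `` {x}"
    using D by blast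
  then show "D \<in> comps r Y"
    using x D by (auto simp: comps_def quotient_def)
qed

lemma comps_memberD:
  assumes "sym r" "D \<in> comps r Y" "u \<in> D"
  shows "D = rtrancl_on Y r `` {u}" "u \<in> Y"
  using assms quotient_eq_iff[OF equiv_rtrancl_on[of r Y]] in_quotient_imp_subset[OF equiv_rtrancl_on[of r Y]]
  by (auto simp: comps_def quotient_def dest: in_rtrancl_on_in_F
      intro: rtrancl_on_trans rtrancl_on_symD)

lemma comps_nonempty: "sym r \<Longrightarrow> D \<in> comps r Y \<Longrightarrow> D \<noteq> {}"
  by (auto simp: comps_def quotient_def)

lemma compsI: "x \<in> Y \<Longrightarrow> rtrancl_on Y r `` {x} \<in> comps r Y"
  by (auto simp: comps_def quotient_def)

text \<open>From a component \<open>D\<close> of \<open>W\<close>, a step inside \<open>W\<close>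
  stays in \<open>D\<close>, and a step out of \<open>W\<close> enters \<open>X\<close>, where
  \<open>D\<close> is still a whole component. So no walk from \<open>D\<close> ever reaches
  \<open>C\<close>.\<close>

lemma isolated_component_not_conn:
  assumes r: "sym r" and D: "D \<in> comps r W" "D \<in> comps r (W \<union> X)"
    and X: "\<And>u v. u \<in> W \<Longrightarrow> v \<in> C \<Longrightarrow> (u, v) \<in> r \<Longrightarrow> v \<in> X"
    and C: "C \<noteq> {}" "C \<inter> W = {}"
  shows "\<not> conn r (C \<union> W)"
proof
  assume conn: "conn r (C \<union> W)"
  obtain d where d: "d \<in> D" using comps_nonempty[OF r D(1)] by auto
  obtain c where c: "c \<in> C" using C by auto
  have "v \<in> D" if "(d, v) \<in> rtrancl_on (C \<union> W) r" for v
    using that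
  proof (induct rule: rtrancl_on_induct)
    case base
    then show ?case using d by simp
  next
    case (step y z)
    have y: "y \<in> W" using comps_memberD[OF r D(1)] step by auto
    have "z \<in> W \<or> z \<in> X" using step X y by auto
    then have "(y, z) \<in> rtrancl_on W r \<or> (y, z) \<in> rtrancl_on (W \<union> X) r"
      using y step(2) by (auto intro!: rtrancl_on_edge)
    then show ?case
      using comps_memberD(1)[OF r D(1) step(5)] comps_memberD(1)[OF r D(2) step(5)] by auto
  qed
  moreover have "(d, c) \<in> rtrancl_on (C \<union> W) r"
    using conn c d comps_memberD[OF r D(1) d] by (auto simp: conn_def)
  ultimately have "c \<in> D" by blast
  then show False using c C comps_memberD(2)[OF r D(1)] by auto
qed

text \<open>If the class of \<open>w\<close> in \<open>W \<union> X\<close> missed \<open>X\<close>,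
  every walk from \<open>w\<close> would stay in \<open>W\<close>, and that class would be a
  component of both sets.\<close>

lemma no_common_component_meets:
  assumes r: "sym r" and dis: "comps r W \<inter> comps r (W \<union> X) = {}" and w: "w \<in> W"
  shows "\<exists>x\<in>X. (w, x) \<in> rtrancl_on (W \<union> X) r"
proof (rule ccontr)
  assume *: "\<not> ?thesis"
  have "(w, v) \<in> rtrancl_on W r" if "(w, v) \<in> rtrancl_on (W \<union> X) r" for v
    using that
  proof (induct rule: rtrancl_on_induct)
    case base
    then show ?case using w by simp
  next
    case (step y z)
    then have "(w, z) \<in> rtrancl_on (W \<union> X) r" by (blast intro: rtrancl_on_into_rtrancl_on)
    then have "z \<in> W" using * in_rtrancl_on_in_F(2)[of w z] by blast
    then show ?case using step by (blast intro: rtrancl_on_into_rtrancl_on)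
  qed
  then have "rtrancl_on (W \<union> X) r `` {w} = rtrancl_on W r `` {w}"
    using rtrancl_on_subset[of W "W \<union> X"] by blast
  with w dis show False
    using compsI[of w W r] compsI[of w "W \<union> X" r] by auto
qed

text \<open>Every class of \<open>W \<union> X\<close> meets \<open>X\<close>, so it is generated by
  a component of \<open>X\<close>. This gives a surjection from the components of \<open>X\<close>
  whose fibres are the groups that \<open>W\<close> merges.\<close>

lemma comps_union_image:
  assumes r: "sym r" and meets: "\<And>w. w \<in> W \<Longrightarrow> \<exists>x\<in>X. (w, x) \<in> rtrancl_on (W \<union> X) r"
  shows "comps r (W \<union> X) = (\<lambda>A. rtrancl_on (W \<union> X) r `` A) ` comps r X"
    and "x \<in> X \<Longrightarrow> rtrancl_on (W \<union> X) r `` (rtrancl_on X r `` {x}) = rtrancl_on (W \<union> X) r `` {x}"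
proof -
  show cl: "rtrancl_on (W \<union> X) r `` (rtrancl_on X r `` {x}) = rtrancl_on (W \<union> X) r `` {x}"
    if "x \<in> X" for x
    using that rtrancl_on_subset[of X "W \<union> X"] by (blast intro: rtrancl_on_trans)
  have ex: "\<exists>x\<in>X. rtrancl_on (W \<union> X) r `` {v} = rtrancl_on (W \<union> X) r `` {x}" if "v \<in> W \<union> X" for v
    using that meets[of v] equiv_class_eq[OF equiv_rtrancl_on[OF r]] by blast
  show "comps r (W \<union> X) = (\<lambda>A. rtrancl_on (W \<union> X) r `` A) ` comps r X"
  proof (intro set_eqI iffI)
    fix D assume "D \<in> comps r (W \<union> X)"
    then obtain v where "v \<in> W \<union> X" "D = rtrancl_on (W \<union> X) r `` {v}"
      by (auto simp: comps_def quotient_def)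
    with ex obtain x where x: "x \<in> X" "D = rtrancl_on (W \<union> X) r `` {x}" by metis
    show "D \<in> (\<lambda>A. rtrancl_on (W \<union> X) r `` A) ` comps r X"
      using x(2) compsI[OF x(1), of r] unfolding cl[OF x(1), symmetric] by blast
  next
    fix D assume "D \<in> (\<lambda>A. rtrancl_on (W \<union> X) r `` A) ` comps r X"
    then obtain x where x: "x \<in> X" "D = rtrancl_on (W \<union> X) r `` (rtrancl_on X r `` {x})"
      by (auto simp: comps_def quotient_def)
    then show "D \<in> comps r (W \<union> X)" using cl[OF x(1)] compsI[of x "W \<union> X" r] by auto
  qed
qed

section \<open>Counting the components that are merged\<close>

lemma finite_comps: "finite X \<Longrightarrow> finite (comps r X)"
  by (simp add: comps_def quotient_def)

lemma card_comps_union_le: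
  assumes "sym r" "finite X" "\<And>w. w \<in> W \<Longrightarrow> \<exists>x\<in>X. (w, x) \<in> rtrancl_on (W \<union> X) r"
  shows "card (comps r (W \<union> X)) \<le> card (comps r X)"
  using comps_union_image(1)[OF assms(1,3)] card_image_le[OF finite_comps[OF assms(2)]] by metis

text \<open>A surjection between finite sets of equal size is injective: equal component counts mean
  that \<open>W\<close> merges nothing.\<close>

lemma card_comps_union_eqD:
  assumes r: "sym r" and "finite X"
    and meets: "\<And>w. w \<in> W \<Longrightarrow> \<exists>x\<in>X. (w, x) \<in> rtrancl_on (W \<union> X) r"
    and eq: "card (comps r (W \<union> X)) = card (comps r X)"
    and xy: "x \<in> X" "y \<in> X" "(x, y) \<in> rtrancl_on (W \<union> X) r"
  shows "(x, y) \<in> rtrancl_on X r"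
proof -
  have "inj_on (\<lambda>A. rtrancl_on (W \<union> X) r `` A) (comps r X)"
    using eq comps_union_image(1)[OF r meets] finite_comps[OF \<open>finite X\<close>]
    by (intro eq_card_imp_inj_on) auto
  moreover have "rtrancl_on (W \<union> X) r `` (rtrancl_on X r `` {x})
      = rtrancl_on (W \<union> X) r `` (rtrancl_on X r `` {y})"
    using comps_union_image(2)[of r W X, OF r meets] xy equiv_class_eq[OF equiv_rtrancl_on[OF r] xy(3)]
    by simp
  ultimately have "rtrancl_on X r `` {x} = rtrancl_on X r `` {y}"
    using compsI[OF xy(1), of r] compsI[OF xy(2), of r] by (auto dest: inj_onD)
  then show ?thesis using xy(2) by auto
qed

text \<open>Induction along a walk whose excursions into \<open>W\<close> are simulated in
  \<open>W'\<close>. While the walk is inside \<open>W\<close>, the invariant remembers the vertex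
  \<open>x\<close> of \<open>X\<close> at which it left \<open>C\<close>; on its return to
  \<open>C\<close> the hypothesis \<open>sub\<close> supplies the detour through
  \<open>W'\<close>.\<close>

lemma rtrancl_on_replace:
  assumes "(u, v) \<in> rtrancl_on (C \<union> W) r" "u \<in> C" "X \<subseteq> C" "C \<inter> W = {}"
    and X: "\<And>u v. u \<in> C \<Longrightarrow> v \<in> W \<Longrightarrow> (u, v) \<in> r \<or> (v, u) \<in> r \<Longrightarrow> u \<in> X"
    and sub: "\<And>x y. x \<in> X \<Longrightarrow> y \<in> X \<Longrightarrow> (x, y) \<in> rtrancl_on (W \<union> X) r
           \<Longrightarrow> (x, y) \<in> rtrancl_on (W' \<union> X) r"
  shows "(v \<in> C \<longrightarrow> (u, v) \<in> rtrancl_on (C \<union> W') r) \<and>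
     (v \<in> W \<longrightarrow> (\<exists>x\<in>X. (u, x) \<in> rtrancl_on (C \<union> W') r \<and> (x, v) \<in> rtrancl_on (W \<union> X) r))"
  using assms(1)
proof (induct rule: rtrancl_on_induct)
  case base
  then show ?case using assms by auto
next
  case (step y z)
  consider "y \<in> C" "z \<in> C" | "y \<in> C" "z \<in> W" | "y \<in> W" "z \<in> W" | "y \<in> W" "z \<in> C"
    using step by auto
  then show ?case
  proof cases
    case 1
    then have "(u, z) \<in> rtrancl_on (C \<union> W') r"
      using step by (blast intro: rtrancl_on_into_rtrancl_on)
    then show ?thesis using 1 assms by auto
  next
    case 2
    then have "y \<in> X" using step X by blast
    moreover have "(y, z) \<in> rtrancl_on (W \<union> X) r"
      using 2 \<open>y \<in> X\<close> step by (intro rtrancl_on_edge) auto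
    ultimately show ?thesis using 2 step assms by blast
  next
    case 3
    then obtain x where "x \<in> X" "(u, x) \<in> rtrancl_on (C \<union> W') r" "(x, y) \<in> rtrancl_on (W \<union> X) r"
      using step by blast
    moreover have "(x, z) \<in> rtrancl_on (W \<union> X) r"
      using 3 calculation step by (blast intro: rtrancl_on_into_rtrancl_on)
    ultimately show ?thesis using 3 assms by blast
  next
    case 4
    then obtain x where x: "x \<in> X" "(u, x) \<in> rtrancl_on (C \<union> W') r" "(x, y) \<in> rtrancl_on (W \<union> X) r"
      using step by blast
    have "z \<in> X" using 4 step X by blast
    have "(x, z) \<in> rtrancl_on (W \<union> X) r"
      using \<open>z \<in> X\<close> x step by (blast intro: rtrancl_on_into_rtrancl_on)
    then have "(x, z) \<in> rtrancl_on (W' \<union> X) r"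
      using sub x \<open>z \<in> X\<close> by blast
    then have "(x, z) \<in> rtrancl_on (C \<union> W') r"
      using \<open>X \<subseteq> C\<close> by (auto intro: rtrancl_on_subset[of "W' \<union> X"])
    with x(2) have "(u, z) \<in> rtrancl_on (C \<union> W') r" by (rule rtrancl_on_trans)
    then show ?thesis using 4 assms by auto
  qed
qed

text \<open>Walks between vertices of \<open>C\<close> are simulated, and \<open>meets\<close> ties
  each vertex of \<open>W'\<close> to \<open>X\<close>, hence to \<open>C\<close>.\<close>

lemma conn_replace_imp:
  assumes r: "sym r" and C: "conn r (C \<union> W)" "C \<noteq> {}" "X \<subseteq> C" "C \<inter> W = {}"
    and X: "\<And>u v. u \<in> C \<Longrightarrow> v \<in> W \<Longrightarrow> (u, v) \<in> r \<Longrightarrow> u \<in> X"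
    and meets: "\<And>w. w \<in> W' \<Longrightarrow> \<exists>x\<in>X. (w, x) \<in> rtrancl_on (W' \<union> X) r"
    and sub: "\<And>x y. x \<in> X \<Longrightarrow> y \<in> X \<Longrightarrow> (x, y) \<in> rtrancl_on (W \<union> X) r
           \<Longrightarrow> (x, y) \<in> rtrancl_on (W' \<union> X) r"
  shows "conn r (C \<union> W')"
proof -
  have X': "\<And>u v. u \<in> C \<Longrightarrow> v \<in> W \<Longrightarrow> (u, v) \<in> r \<or> (v, u) \<in> r \<Longrightarrow> u \<in> X"
    using X symD[OF r] by blast
  have CC: "(u, v) \<in> rtrancl_on (C \<union> W') r" if "u \<in> C" "v \<in> C" for u v
    using rtrancl_on_replace[of u v C W r X W', OF _ that(1) C(3,4) X' sub] C(1) that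
    by (auto simp: conn_def)
  have ex: "\<exists>c\<in>C. (u, c) \<in> rtrancl_on (C \<union> W') r" if "u \<in> C \<union> W'" for u
  proof (cases "u \<in> C")
    case True
    then show ?thesis using CC by blast
  next
    case False
    then have "u \<in> W'" using that by blast
    from meets[OF this] obtain x where "x \<in> X" "(u, x) \<in> rtrancl_on (W' \<union> X) r" by blast
    then show ?thesis
      using C(3) rtrancl_on_subset[of "W' \<union> X" "C \<union> W'" u x r] by blast
  qed
  show ?thesis
    unfolding conn_def using C(2)
    by (auto intro: rtrancl_on_trans rtrancl_on_symD[OF r] CC dest!: ex)
       (metis CC Un_iff ex r rtrancl_on_symD rtrancl_on_trans)+
qed

lemma conn_replace_iff:
  assumes r: "sym r" and C: "C \<noteq> {}" "X \<subseteq> C" "C \<inter> W = {}" "C \<inter> W' = {}"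
    and X: "\<And>u v. u \<in> C \<Longrightarrow> v \<in> W \<Longrightarrow> (u, v) \<in> r \<Longrightarrow> u \<in> X"
      "\<And>u v. u \<in> C \<Longrightarrow> v \<in> W' \<Longrightarrow> (u, v) \<in> r \<Longrightarrow> u \<in> X"
    and meets: "\<And>w. w \<in> W \<Longrightarrow> \<exists>x\<in>X. (w, x) \<in> rtrancl_on (W \<union> X) r"
      "\<And>w. w \<in> W' \<Longrightarrow> \<exists>x\<in>X. (w, x) \<in> rtrancl_on (W' \<union> X) r"
    and same: "\<And>x y. x \<in> X \<Longrightarrow> y \<in> X \<Longrightarrow> (x, y) \<in> rtrancl_on (W \<union> X) r
           \<longleftrightarrow> (x, y) \<in> rtrancl_on (W' \<union> X) r"
  shows "conn r (C \<union> W) \<longleftrightarrow> conn r (C \<union> W')"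
proof
  assume "conn r (C \<union> W)"
  then show "conn r (C \<union> W')"
    by (rule conn_replace_imp[OF r _ C(1-3) X(1) meets(2)]) (use same in auto)
next
  assume "conn r (C \<union> W')"
  then show "conn r (C \<union> W)"
    by (rule conn_replace_imp[OF r _ C(1,2,4) X(2) meets(1)]) (use same in auto)
qed

section \<open>Sets filling the first columns\<close>

text \<open>No bound by \<open>m\<close> or \<open>n\<close> is built in: one relation serves all
  the graphs that occur as the recursion changes the number of columns, and the boundary enters only
  through \<open>box\<close>.\<close>

definition grid :: "(nat \<times> nat) rel" where
  "grid = {((i, j), (i', j')). i = i' \<and> (j' = j + 1 \<or> j = j' + 1) \<or> j = j' \<and> (i' = i + 1 \<or> i = i' + 1)}"

definition complete_grid :: "(nat \<times> nat) rel" where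
  "complete_grid = {((i, j), (i', j')). i = i' \<and> (j' = j + 1 \<or> j = j' + 1) \<or> j = j' \<and> i \<noteq> i'}"

definition box :: "nat \<Rightarrow> nat \<Rightarrow> (nat \<times> nat) set" where
  "box m n = {1..m} \<times> {1..n}"

lemma sym_grid: "sym grid" and sym_complete_grid: "sym complete_grid"
  by (auto simp: grid_def complete_grid_def sym_def)

lemma finite_box [simp]: "finite (box m n)"
  by (simp add: box_def)

lemma mem_column_iff: "v \<in> column m j \<longleftrightarrow> 1 \<le> fst v \<and> fst v \<le> m \<and> snd v = j"
  by (cases v) (auto simp: column_def)

lemma mem_box_iff: "v \<in> box m n \<longleftrightarrow> 1 \<le> fst v \<and> fst v \<le> m \<and> 1 \<le> snd v \<and> snd v \<le> n"
  by (cases v) (auto simp: box_def)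

lemma column_subset_box: "1 \<le> j \<Longrightarrow> j \<le> n \<Longrightarrow> column m j \<subseteq> box m n"
  by (auto simp: mem_column_iff mem_box_iff)

lemma finite_column [simp]: "finite (column m j)"
  by (rule finite_subset[of _ "{1..m} \<times> {j}"]) (auto simp: column_def)

section \<open>From the product graphs to \<open>grid\<close> and
  \<open>complete_grid\<close>\<close>

lemma verts_PP [simp]: "verts (PP m n) = box m n" and verts_KP [simp]: "verts (KP m n) = box m n"
  by (auto simp: cart_prod_def path_graph_def complete_graph_def box_def)

lemma parcs_PP:
  "u \<in> box m n \<Longrightarrow> v \<in> box m n
    \<Longrightarrow> (u, v) \<in> parcs (cart_prod (path_graph m) (path_graph n)) \<longleftrightarrow> (u, v) \<in> grid"
  by (auto simp: cart_prod_def path_graph_def box_def grid_def)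

lemma parcs_KP:
  "u \<in> box m n \<Longrightarrow> v \<in> box m n
    \<Longrightarrow> (u, v) \<in> parcs (cart_prod (complete_graph m) (path_graph n)) \<longleftrightarrow> (u, v) \<in> complete_grid"
  by (auto simp: cart_prod_def path_graph_def complete_graph_def box_def complete_grid_def)

lemma connected_PP_induce:
  assumes "C \<subseteq> box m n"
  shows "connected (PP m n \<restriction> C) \<longleftrightarrow> conn grid C"
proof (rule connected_induce_iff_conn[OF sym_grid])
  fix u v assume "u \<in> C" "v \<in> C"
  with assms have "u \<in> box m n" "v \<in> box m n" by blast+
  then show "(u, v) \<in> arcs_ends (PP m n) \<longleftrightarrow> (u, v) \<in> grid"
    using parcs_PP[of u m n v] by simp
qed

lemma connected_KP_induce:
  assumes "C \<subseteq> box m n"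
  shows "connected (KP m n \<restriction> C) \<longleftrightarrow> conn complete_grid C"
proof (rule connected_induce_iff_conn[OF sym_complete_grid])
  fix u v assume "u \<in> C" "v \<in> C"
  with assms have "u \<in> box m n" "v \<in> box m n" by blast+
  then show "(u, v) \<in> arcs_ends (KP m n) \<longleftrightarrow> (u, v) \<in> complete_grid"
    using parcs_KP[of u m n v] by simp
qed

lemma connected_sets_PP: "connected_sets (PP m n) = {C. C \<subseteq> box m n \<and> conn grid C}"
  unfolding connected_sets_def verts_PP using connected_PP_induce by (auto simp only: conn_def)

lemma connected_sets_KP: "connected_sets (KP m n) = {C. C \<subseteq> box m n \<and> conn complete_grid C}"
  unfolding connected_sets_def verts_KP using connected_KP_induce by (auto simp only: conn_def)

lemma components_PP:
  assumes "Y \<subseteq> box m n"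
  shows "components (PP m n \<restriction> Y) = comps grid Y"
proof -
  have "(PP m n \<restriction> Y) \<restriction> D = PP m n \<restriction> D" if "D \<subseteq> Y" for D
    using that by (auto simp: induce_subgraph_def)
  moreover have "connected (PP m n \<restriction> D) \<longleftrightarrow> conn grid D" if "D \<subseteq> Y" for D
    using that assms by (intro connected_PP_induce) auto
  ultimately have "connected_sets (PP m n \<restriction> Y) = {D. D \<subseteq> Y \<and> conn grid D}"
    unfolding connected_sets_def induce_subgraph_verts by (auto simp only: conn_def)
  then show ?thesis
    unfolding components_def comps_eq_maximal_conn[OF sym_grid] by auto
qed

text \<open>Even when columns are complete graphs, arcs between neighbouring columns join equal rows
  only. Writing the column as \<open>k + 1\<close> avoids truncated subtraction.\<close>

lemma prev_col_eq:
  assumes "S \<subseteq> column m (k + 1)" "1 \<le> k"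
  shows "prev_col m (k + 1) S = {(i, k) |i. (i, k + 1) \<in> S}"
proof -
  have adj: "v \<rightarrow>\<^bsub>KP m (k + 1)\<^esub> s \<longleftrightarrow> s = (fst v, k + 1)" if "s \<in> S" "v \<in> column m k" for v s
  proof -
    have "s \<in> column m (k + 1)" using that assms by blast
    then have "s \<in> box m (k + 1)" "v \<in> box m (k + 1)" "snd s = k + 1" "snd v = k"
      using that assms by (auto simp: mem_box_iff mem_column_iff)
    then show ?thesis
      using parcs_KP[of v m "k + 1" s] by (cases v; cases s) (auto simp: complete_grid_def)
  qed
  have "prev_col m (k + 1) S = {v \<in> column m k. \<exists>s\<in>S. s = (fst v, k + 1)}"
    unfolding prev_col_def add_diff_cancel_right' using adj by blast
  also have "\<dots> = {v \<in> column m k. (fst v, k + 1) \<in> S}"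
    by blast
  also have "\<dots> = {(i, k) |i. (i, k + 1) \<in> S}"
    using assms(1) by (auto simp: column_def)
  finally show ?thesis .
qed

text \<open>Passing from column \<open>j\<close> to column \<open>j + 1\<close> uses one row in
  both. Conversely every column is a clique, so one shared row per neighbouring pair leads from any
  vertex down to column 1.\<close>

lemma conn_complete_grid_iff:
  assumes C: "C \<subseteq> box m n" and ne: "\<And>j. j \<in> {1..n} \<Longrightarrow> C \<inter> column m j \<noteq> {}" and n: "1 \<le> n"
  shows "conn complete_grid C \<longleftrightarrow> (\<forall>j. 1 \<le> j \<and> j < n \<longrightarrow> (\<exists>i. (i, j) \<in> C \<and> (i, j + 1) \<in> C))"
proof
  assume conn: "conn complete_grid C"
  show "\<forall>j. 1 \<le> j \<and> j < n \<longrightarrow> (\<exists>i. (i, j) \<in> C \<and> (i, j + 1) \<in> C)"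
  proof (intro allI impI)
    fix j assume j: "1 \<le> j \<and> j < n"
    obtain u where u: "u \<in> C" "snd u = j" using ne[of j] j by (fastforce simp: mem_column_iff)
    obtain w where w: "w \<in> C" "snd w = j + 1" using ne[of "j + 1"] j by (fastforce simp: mem_column_iff)
    \<comment> \<open>A walk starting in column \<open>j\<close> cannot get past that column without
      exhibiting a shared row.\<close>
    have "snd v \<le> j \<or> (\<exists>i. (i, j) \<in> C \<and> (i, j + 1) \<in> C)" if "(u, v) \<in> rtrancl_on C complete_grid" for v
      using that
    proof (induct rule: rtrancl_on_induct)
      case base
      then show ?case using u by simp
    next
      case (step y z)
      show ?case
      proof (cases "snd y \<le> j \<and> \<not> snd z \<le> j")
        case True
        then have "y = (fst y, j)" "z = (fst y, j + 1)"
          using step(2) by (cases y; cases z; auto simp: complete_grid_def)+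
        then show ?thesis using step(3,4) by metis
      next
        case False
        then show ?thesis using step by blast
      qed
    qed
    from this[of w] show "\<exists>i. (i, j) \<in> C \<and> (i, j + 1) \<in> C"
      using conn u w by (auto simp: conn_def)
  qed
next
  assume link: "\<forall>j. 1 \<le> j \<and> j < n \<longrightarrow> (\<exists>i. (i, j) \<in> C \<and> (i, j + 1) \<in> C)"
  have column: "(u, v) \<in> rtrancl_on C complete_grid" if "u \<in> C" "v \<in> C" "snd u = snd v" for u v
  proof (cases "u = v")
    case False
    then have "(u, v) \<in> complete_grid"
      using that by (cases u; cases v) (auto simp: complete_grid_def)
    then show ?thesis using that by (auto intro: rtrancl_on_edge)
  qed (use that in auto)
  obtain w where w: "w \<in> C" "snd w = 1" using ne[of 1] n by (fastforce simp: mem_column_iff)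
  have to_w: "(v, w) \<in> rtrancl_on C complete_grid" if "v \<in> C" "snd v = j" "1 \<le> j" for v j
    using that(3,1,2)
  proof (induct j arbitrary: v rule: dec_induct)
    case base
    then show ?case using column w by auto
  next
    case (step j)
    then have "Suc j \<le> n" using C by (auto simp: mem_box_iff)
    with link step(1) obtain i where i: "(i, j) \<in> C" "(i, j + 1) \<in> C" by auto
    have "(v, (i, j + 1)) \<in> rtrancl_on C complete_grid"
      using i step by (intro column) auto
    moreover have "((i, j + 1), (i, j)) \<in> rtrancl_on C complete_grid"
      using i by (intro rtrancl_on_edge) (auto simp: complete_grid_def)
    moreover have "((i, j), w) \<in> rtrancl_on C complete_grid"
      using i step by auto
    ultimately show ?case by (blast intro: rtrancl_on_trans)
  qed
  have to_w': "(v, w) \<in> rtrancl_on C complete_grid" if "v \<in> C" for v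
    using that to_w[of v "snd v"] C by (auto simp: mem_box_iff)
  show "conn complete_grid C"
    unfolding conn_def using w to_w' rtrancl_on_symD[OF sym_complete_grid]
    by (blast intro: rtrancl_on_trans)
qed

lemma full_sets_iff:
  assumes "1 \<le> n"
  shows "C \<in> full_sets m n \<longleftrightarrow> C \<subseteq> box m n \<and> (\<forall>j\<in>{1..n}. C \<inter> column m j \<noteq> {})
    \<and> (\<forall>j. 1 \<le> j \<and> j < n \<longrightarrow> (\<exists>i. (i, j) \<in> C \<and> (i, j + 1) \<in> C))"
  using conn_complete_grid_iff[of C m n] assms
  by (auto simp: full_sets_def connected_sets_KP)

lemma full_sets_subset: "C \<in> full_sets m n \<Longrightarrow> C \<subseteq> box m n"
  by (simp add: full_sets_def connected_sets_KP)

lemma finite_full_sets [simp]: "finite (full_sets m n)"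
  by (rule finite_subset[of _ "Pow (box m n)"]) (auto dest: full_sets_subset)

lemma full_sets'_eq: "full_sets' m n = {C \<in> full_sets m n. \<not> conn grid C}"
  by (auto simp: full_sets_def full_sets'_def connected_sets_KP connected_sets_PP)

text \<open>The criterion by shared rows is local: a new last column \<open>S\<close> affects only
  the link between columns \<open>k\<close> and \<open>k + 1\<close>.\<close>

lemma full_sets_Suc_iff:
  assumes "1 \<le> k" "C \<subseteq> box m k" "S \<subseteq> column m (k + 1)"
  shows "C \<union> S \<in> full_sets m (k + 1)
    \<longleftrightarrow> C \<in> full_sets m k \<and> (C \<inter> column m k) \<inter> prev_col m (k + 1) S \<noteq> {}" (is "?L \<longleftrightarrow> ?R")
proof -
  have col: "(C \<union> S) \<inter> column m j = C \<inter> column m j" if "j \<le> k" for j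
    using that assms by (auto simp: mem_column_iff)
  have link: "(i, j) \<in> C \<union> S \<and> (i, j + 1) \<in> C \<union> S \<longleftrightarrow> (i, j) \<in> C \<and> (i, j + 1) \<in> C" if "j < k" for i j
    using that assms by (auto simp: mem_column_iff)
  have lastlink: "(i, k) \<in> C \<union> S \<and> (i, k + 1) \<in> C \<union> S
      \<longleftrightarrow> (i, k) \<in> (C \<inter> column m k) \<inter> prev_col m (k + 1) S" for i
    unfolding prev_col_eq[OF assms(3,1)] using assms by (auto simp: mem_column_iff mem_box_iff)
  have prev: "prev_col m (k + 1) S \<subseteq> {(i, k) |i. True}"
    unfolding prev_col_eq[OF assms(3,1)] by auto
  show ?thesis
  proof
    assume L: ?L
    then have *: "\<forall>j\<in>{1..k + 1}. (C \<union> S) \<inter> column m j \<noteq> {}"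
      "\<forall>j. 1 \<le> j \<and> j < k + 1 \<longrightarrow> (\<exists>i. (i, j) \<in> C \<union> S \<and> (i, j + 1) \<in> C \<union> S)"
      using full_sets_iff[of "k + 1" "C \<union> S" m] by auto
    have "\<forall>j\<in>{1..k}. C \<inter> column m j \<noteq> {}"
      using * col by force
    moreover have "\<forall>j. 1 \<le> j \<and> j < k \<longrightarrow> (\<exists>i. (i, j) \<in> C \<and> (i, j + 1) \<in> C)"
      using *(2) link by (metis less_SucI Suc_eq_plus1)
    moreover have "(C \<inter> column m k) \<inter> prev_col m (k + 1) S \<noteq> {}"
      using *(2)[rule_format, of k] lastlink assms(1) by auto
    ultimately show ?R
      using assms full_sets_iff[of k C m] by auto
  next
    assume R: ?R
    then obtain i where i: "(i, k) \<in> (C \<inter> column m k) \<inter> prev_col m (k + 1) S"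
      using prev by fast
    have C: "\<forall>j\<in>{1..k}. C \<inter> column m j \<noteq> {}"
      "\<forall>j. 1 \<le> j \<and> j < k \<longrightarrow> (\<exists>i. (i, j) \<in> C \<and> (i, j + 1) \<in> C)"
      using R full_sets_iff[of k C m] assms(1) by auto
    have "(C \<union> S) \<inter> column m j \<noteq> {}" if "j \<in> {1..k + 1}" for j
    proof (cases "j = k + 1")
      case True
      then show ?thesis
        using i assms(3) unfolding prev_col_eq[OF assms(3,1)] by auto
    next
      case False
      then show ?thesis using that C col[of j] by auto
    qed
    moreover have "\<exists>i. (i, j) \<in> C \<union> S \<and> (i, j + 1) \<in> C \<union> S" if "1 \<le> j \<and> j < k + 1" for j
    proof (cases "j = k")
      case True
      then show ?thesis using lastlink i by blast
    next
      case False
      then show ?thesis using that C(2)[rule_format, of j] by auto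
    qed
    moreover have "C \<union> S \<subseteq> box m (k + 1)"
      using assms by (force simp: mem_box_iff mem_column_iff)
    ultimately show ?L
      using full_sets_iff[of "k + 1" "C \<union> S" m] by auto
  qed
qed

text \<open>The state of the recursion: \<open>X\<close> is the interface and \<open>W\<close> the
  context to its right. Membership in \<open>full_sets\<close> concerns \<open>C\<close> alone,
  since the links of the removed columns are secured by the ranges of the sums over columns.\<close>

definition defective :: "nat \<Rightarrow> nat \<Rightarrow> (nat \<times> nat) set \<Rightarrow> (nat \<times> nat) set \<Rightarrow> (nat \<times> nat) set set" where
  "defective m k X W = {C \<in> full_sets m k. C \<inter> column m k = X \<and> \<not> conn grid (C \<union> W)}"

lemma finite_defective [simp]: "finite (defective m k X W)"
  by (simp add: defective_def)

text \<open>Removing the last column \<open>S\<close> from a set moves it into the context;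
  \<open>C \<union> S\<close> stays the same and so does its being disconnected in the grid.\<close>

lemma defective_slice:
  assumes k: "1 \<le> k" and S: "S \<subseteq> column m (k + 1)" and T: "T \<inter> prev_col m (k + 1) S \<noteq> {}"
  shows "card {F \<in> defective m (k + 1) S W. F \<inter> column m k = T} = card (defective m k T (S \<union> W))"
proof -
  have col: "(C \<union> S) \<inter> column m (k + 1) = S" "(C \<union> S) \<inter> column m k = C \<inter> column m k"
    "(C \<union> S) \<inter> box m k = C" if "C \<subseteq> box m k" for C
    using that S by (force simp: mem_column_iff mem_box_iff)+
  have "{F \<in> defective m (k + 1) S W. F \<inter> column m k = T} = (\<lambda>C. C \<union> S) ` defective m k T (S \<union> W)"
    (is "?A = ?B")
  proof (intro set_eqI iffI)
    fix F assume F: "F \<in> ?A"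
    define C where "C = F \<inter> box m k"
    have FC: "F = C \<union> S"
      using F full_sets_subset[of F m "k + 1"]
      by (force simp: defective_def C_def mem_box_iff mem_column_iff)
    have C: "C \<subseteq> box m k" by (simp add: C_def)
    have "C \<in> full_sets m k" "C \<inter> column m k = T"
      using F full_sets_Suc_iff[OF k C S] col[OF C] by (auto simp: defective_def FC)
    then have "C \<in> defective m k T (S \<union> W)"
      using F by (auto simp: defective_def FC Un_assoc)
    with FC show "F \<in> ?B" by blast
  next
    fix F assume "F \<in> ?B"
    then obtain C where C: "C \<in> defective m k T (S \<union> W)" and F: "F = C \<union> S" by blast
    then have sub: "C \<subseteq> box m k" by (auto simp: defective_def dest: full_sets_subset)
    show "F \<in> ?A"
      using C T full_sets_Suc_iff[OF k sub S] col[OF sub] by (auto simp: defective_def F Un_assoc)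
  qed
  moreover have "inj_on (\<lambda>C. C \<union> S) (defective m k T (S \<union> W))"
    by (rule inj_onI) (metis (no_types, lifting) col(3) defective_def full_sets_subset mem_Collect_eq)
  ultimately show ?thesis by (simp add: card_image)
qed

text \<open>Accounts for the index set of the sum over \<open>T\<close>: a next-to-last column that
  misses \<open>prev_col\<close> of \<open>S\<close> belongs to no full set.\<close>

lemma defective_slice_empty:
  assumes k: "1 \<le> k" and S: "S \<subseteq> column m (k + 1)" and F: "F \<in> defective m (k + 1) S W"
  shows "(F \<inter> column m k) \<inter> prev_col m (k + 1) S \<noteq> {}"
proof -
  define C where "C = F \<inter> box m k"
  have FC: "F = C \<union> S"
    using F full_sets_subset[of F m "k + 1"]
    by (force simp: defective_def C_def mem_box_iff mem_column_iff)
  have C: "C \<subseteq> box m k" by (simp add: C_def)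
  show ?thesis
    using F full_sets_Suc_iff[OF k C S] by (auto simp: defective_def FC)
qed

lemma card_defective_Suc:
  assumes k: "1 \<le> k" and S: "S \<subseteq> column m (k + 1)"
  shows "card (defective m (k + 1) S W)
    = (\<Sum>T | T \<subseteq> column m k \<and> T \<inter> prev_col m (k + 1) S \<noteq> {}. card (defective m k T (S \<union> W)))"
proof -
  let ?I = "{T. T \<subseteq> column m k \<and> T \<inter> prev_col m (k + 1) S \<noteq> {}}"
  have "finite ?I"
    by (rule finite_subset[of _ "Pow (column m k)"]) auto
  moreover have "defective m (k + 1) S W = (\<Union>T\<in>?I. {F \<in> defective m (k + 1) S W. F \<inter> column m k = T})"
    using defective_slice_empty[OF k S] by auto
  ultimately have "card (defective m (k + 1) S W)
      = (\<Sum>T\<in>?I. card {F \<in> defective m (k + 1) S W. F \<inter> column m k = T})"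
    by (subst (asm) (2) eq_commute, subst card_UN_disjoint[symmetric]) auto
  also have "\<dots> = (\<Sum>T\<in>?I. card (defective m k T (S \<union> W)))"
    using defective_slice[OF k S] by (intro sum.cong) auto
  finally show ?thesis .
qed

text \<open>\<open>agrees\<close> leaves every column free that its argument misses, so with
  \<open>S = {}\<close> it would hold for all \<open>C\<close>.\<close>

lemma agrees_column:
  assumes "S \<subseteq> column m n" "S \<noteq> {}" "1 \<le> n"
  shows "agrees m n S C \<longleftrightarrow> C \<inter> column m n = S"
proof -
  have "S \<inter> column m n = S"
    using assms(1) by blast
  moreover have "S \<inter> column m i = {}" if "i \<noteq> n" for i
    using assms(1) that by (fastforce simp: mem_column_iff)
  moreover have "n \<in> {1..n}"
    using assms(3) by simp
  ultimately show ?thesis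
    unfolding agrees_def using assms(2) by metis
qed

lemma N_fix_eq:
  assumes "S \<subseteq> column m n" "S \<noteq> {}" "1 \<le> n"
  shows "N_fix m n S = card {C \<in> full_sets m n. C \<inter> column m n = S}"
  unfolding N_fix_def agrees_column[OF assms] ..

lemma N_fix'_eq:
  assumes "S \<subseteq> column m n" "S \<noteq> {}" "1 \<le> n"
  shows "N_fix' m n S = card (defective m n S {})"
  unfolding N_fix'_def agrees_column[OF assms] defective_def full_sets'_eq
  by (rule arg_cong[where f = card]) auto

text \<open>The base case of \<open>L2\<close>. That \<open>T\<close> meets \<open>prev_col\<close>
  makes both columns nonempty, so \<open>agrees\<close> really prescribes both.\<close>

lemma N_fix'_two_columns:
  assumes k: "1 \<le> k" and S: "S \<subseteq> column m (k + 1)" and T: "T \<subseteq> column m k" "T \<inter> prev_col m (k + 1) S \<noteq> {}"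
  shows "N_fix' m (k + 1) (S \<union> T) = card (defective m k T S)"
proof -
  have ne: "S \<noteq> {}" "T \<noteq> {}" using T by (auto simp: prev_col_def)
  have col: "(S \<union> T) \<inter> column m (k + 1) = S" "(S \<union> T) \<inter> column m k = T"
    "\<And>i. i \<noteq> k + 1 \<Longrightarrow> i \<noteq> k \<Longrightarrow> (S \<union> T) \<inter> column m i = {}"
    using S T(1) by (force simp: mem_column_iff)+
  have "agrees m (k + 1) (S \<union> T) C \<longleftrightarrow> C \<inter> column m (k + 1) = S \<and> C \<inter> column m k = T" for C
  proof -
    have "agrees m (k + 1) (S \<union> T) C \<longleftrightarrow>
        (\<forall>i\<in>{k, k + 1}. C \<inter> column m i = (S \<union> T) \<inter> column m i)"
    proof
      assume "agrees m (k + 1) (S \<union> T) C"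
      then show "\<forall>i\<in>{k, k + 1}. C \<inter> column m i = (S \<union> T) \<inter> column m i"
        using col ne k by (simp add: agrees_def)
    next
      assume "\<forall>i\<in>{k, k + 1}. C \<inter> column m i = (S \<union> T) \<inter> column m i"
      then show "agrees m (k + 1) (S \<union> T) C"
        unfolding agrees_def using col(3) by (metis insertI1 insertI2)
    qed
    then show ?thesis using col by auto
  qed
  then have "{C \<in> full_sets' m (k + 1). agrees m (k + 1) (S \<union> T) C}
      = {F \<in> defective m (k + 1) S {}. F \<inter> column m k = T}"
    by (auto simp: defective_def full_sets'_eq)
  with defective_slice[OF k S T(2), of "{}"] show ?thesis
    by (simp add: N_fix'_def)
qed

section \<open>Components of a column and the hull\<close>

text \<open>\<open>J\<close> fills the intervals spanned by related rows. By convexity, intervals of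
  different classes neither overlap nor, by \<open>edge\<close>, touch, so a walk through
  \<open>J\<close> and \<open>X\<close> never changes its class. The relation is abstract here
  because only these order properties matter, not how it arises from a context.\<close>

lemma hull_reachability:
  fixes P :: "nat set" and rel :: "nat \<Rightarrow> nat \<Rightarrow> bool" and k :: nat
  defines "X \<equiv> P \<times> {k}"
    and "J \<equiv> {q. \<exists>p1\<in>P. \<exists>p2\<in>P. rel p1 p2 \<and> p1 \<le> q \<and> q \<le> p2} \<times> {k + 1}"
  assumes refl: "\<And>p. p \<in> P \<Longrightarrow> rel p p"
    and sym: "\<And>p q. rel p q \<Longrightarrow> rel q p"
    and trans: "\<And>p q r. rel p q \<Longrightarrow> rel q r \<Longrightarrow> rel p r"
    and edge: "\<And>p. p \<in> P \<Longrightarrow> p + 1 \<in> P \<Longrightarrow> rel p (p + 1)"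
    and convex: "\<And>p q r. p \<in> P \<Longrightarrow> q \<in> P \<Longrightarrow> r \<in> P \<Longrightarrow> p \<le> q \<Longrightarrow> q \<le> r \<Longrightarrow> rel p r \<Longrightarrow> rel p q"
  shows "p \<in> P \<Longrightarrow> q \<in> P \<Longrightarrow> ((p, k), (q, k)) \<in> rtrancl_on (J \<union> X) grid \<longleftrightarrow> rel p q"
    and "w \<in> J \<Longrightarrow> \<exists>x\<in>X. (w, x) \<in> rtrancl_on (J \<union> X) grid"
proof -
  \<comment> \<open>The rows \<open>p1\<close>, \<open>p2\<close> witness that \<open>q\<close>
    belongs to \<open>J\<close>. They are kept as arguments because the class assigned to a vertex
    of \<open>J\<close> has to be shown independent of them.\<close>
  define between where "between q p1 p2 \<longleftrightarrow> p1 \<in> P \<and> p2 \<in> P \<and> rel p1 p2 \<and> p1 \<le> q \<and> q \<le> p2" for q p1 p2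
  have J_iff: "(q, j) \<in> J \<longleftrightarrow> j = k + 1 \<and> (\<exists>p1 p2. between q p1 p2)" for q j
    by (auto simp: J_def between_def)
  have up: "((p, k), (p, k + 1)) \<in> rtrancl_on (J \<union> X) grid" if "p \<in> P" for p
    using that refl[OF that] by (intro rtrancl_on_edge) (auto simp: J_iff X_def between_def grid_def)
  have down: "((p, k + 1), (p, k)) \<in> rtrancl_on (J \<union> X) grid" if "p \<in> P" for p
    using rtrancl_on_symD[OF sym_grid up[OF that]] .
  have along: "((p1, k + 1), (q, k + 1)) \<in> rtrancl_on (J \<union> X) grid" if "between q p1 p2" for q p1 p2
  proof -
    have "p1 \<le> q" using that by (simp add: between_def)
    from this that show ?thesis
    proof (induct q rule: dec_induct)
      case base
      then have "(p1, k + 1) \<in> J" unfolding J_iff by blast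
      then show ?case by blast
    next
      case (step q)
      then have b: "between q p1 p2" "between (Suc q) p1 p2" by (auto simp: between_def)
      have "((q, k + 1), (Suc q, k + 1)) \<in> grid" by (simp add: grid_def)
      moreover have "(Suc q, k + 1) \<in> J \<union> X" using b(2) unfolding J_iff Un_iff by blast
      ultimately show ?case
        using step(3)[OF b(1)] by (rule rtrancl_on_into_rtrancl_on[rotated])
    qed
  qed
  show "\<exists>x\<in>X. (w, x) \<in> rtrancl_on (J \<union> X) grid" if "w \<in> J"
  proof -
    from that obtain q p1 p2 where w: "w = (q, k + 1)" "between q p1 p2"
      by (cases w) (auto simp: J_iff)
    then have p1: "p1 \<in> P" by (simp add: between_def)
    have "(w, (p1, k)) \<in> rtrancl_on (J \<union> X) grid"
      using rtrancl_on_trans[OF rtrancl_on_symD[OF sym_grid along[OF w(2)]] down[OF p1]] w by simp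
    then show ?thesis using p1 by (auto simp: X_def)
  qed
  have rel_reach: "((p, k), (q, k)) \<in> rtrancl_on (J \<union> X) grid" if "p \<in> P" "q \<in> P" "rel p q" "p \<le> q" for p q
  proof -
    have "between q p q" using that by (simp add: between_def)
    from rtrancl_on_trans[OF rtrancl_on_trans[OF up[OF that(1)] along[OF this]] down[OF that(2)]]
    show ?thesis .
  qed
  \<comment> \<open>The larger of the two left ends lies inside the other interval, so convexity
    applies to it.\<close>
  have overlap: "rel p1 p1'" if "between q p1 p2" "between q p1' p2'" for q p1 p2 p1' p2'
  proof (cases "p1 \<le> p1'")
    case True
    then show ?thesis using that convex[of p1 p1' p2] by (auto simp: between_def)
  next
    case False
    then have "rel p1' p1" using that convex[of p1' p1 p2'] by (auto simp: between_def)
    then show ?thesis by (rule sym)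
  qed
  \<comment> \<open>Either one interval contains both rows, or the first ends at \<open>q\<close>
    and the second starts at \<open>q + 1\<close>; both ends are then rows of \<open>P\<close>,
    joined by \<open>edge\<close>.\<close>
  have adjacent: "rel p1 p1'" if b: "between q p1 p2" "between (q + 1) p1' p2'" for q p1 p2 p1' p2'
  proof (cases "q + 1 \<le> p2 \<or> p1' \<le> q")
    case True
    then have "between (q + 1) p1 p2 \<or> between q p1' p2'" using b by (auto simp: between_def)
    then show ?thesis using b overlap by blast
  next
    case False
    then have "p2 = q" "p1' = q + 1" using b by (auto simp: between_def)
    then have "rel p1 q" "rel q p1'" using b edge[of q] by (auto simp: between_def)
    then show ?thesis by (rule trans)
  qed
  \<comment> \<open>For vertices of \<open>J\<close> the invariant speaks of all witnesses, not of
    some; otherwise it could not be passed on to the next vertex.\<close>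
  have reach_rel: "(\<forall>q. v = (q, k) \<longrightarrow> rel p q) \<and> (\<forall>q p1 p2. v = (q, k + 1) \<longrightarrow> between q p1 p2 \<longrightarrow> rel p p1)"
    if "((p, k), v) \<in> rtrancl_on (J \<union> X) grid" "p \<in> P" for p v
    using that(1)
  proof (induct rule: rtrancl_on_induct)
    case base
    then show ?case using refl that(2) by auto
  next
    case (step y z)
    obtain q j q' j' where yz: "y = (q, j)" "z = (q', j')" by (cases y; cases z)
    consider "j = k" "q \<in> P" | "j = k + 1" "\<exists>p1 p2. between q p1 p2"
      using step(3) yz by (auto simp: J_iff X_def)
    note y = this
    consider "j' = k" "q' \<in> P" | "j' = k + 1" "\<exists>p1 p2. between q' p1 p2"
      using step(4) yz by (auto simp: J_iff X_def)
    note z = this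
    show ?case
    proof (cases rule: y)
      case 1
      then have pq: "rel p q" using step yz by auto
      show ?thesis
      proof (cases rule: z)
        case z1: 1
        have "q' = q + 1 \<or> q = q' + 1" using step(2) yz 1 z1 by (auto simp: grid_def)
        then have "rel q q'" using edge[of q] edge[of q'] 1 z1 sym by auto
        then have "rel p q'" using pq trans by blast
        then show ?thesis using yz z1 by auto
      next
        case z2: 2
        have "q' = q" using step(2) yz 1 z2 by (auto simp: grid_def)
        moreover have "between q q q" using 1 refl by (auto simp: between_def)
        ultimately have "rel p p1" if "between q' p1 p2" for p1 p2
          using overlap[of q q q p1 p2] that pq trans by blast
        then show ?thesis using yz z2 by auto
      qed
    next
      case 2
      then obtain p1 p2 where b: "between q p1 p2" by blast
      then have pp1: "rel p p1" using step yz 2 by auto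
      show ?thesis
      proof (cases rule: z)
        case z1: 1
        have "q' = q" using step(2) yz 2 z1 by (auto simp: grid_def)
        then have "between q q q" using z1 refl by (auto simp: between_def)
        then have "rel p q" using overlap[OF b] pp1 trans by blast
        then show ?thesis using yz z1 \<open>q' = q\<close> by auto
      next
        case z2: 2
        have "q' = q + 1 \<or> q = q' + 1" using step(2) yz 2 z2 by (auto simp: grid_def)
        then have "rel p1 p1'" if "between q' p1' p2'" for p1' p2'
          using adjacent[of q p1 p2 p1' p2'] adjacent[of q' p1' p2' p1 p2] that b sym by auto
        then have "rel p p1'" if "between q' p1' p2'" for p1' p2'
          using that pp1 trans by blast
        then show ?thesis using yz z2 by auto
      qed
    qed
  qed
  show "((p, k), (q, k)) \<in> rtrancl_on (J \<union> X) grid \<longleftrightarrow> rel p q" if "p \<in> P" "q \<in> P"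
  proof
    assume "((p, k), (q, k)) \<in> rtrancl_on (J \<union> X) grid"
    then show "rel p q" using reach_rel that by blast
  next
    assume "rel p q"
    then show "((p, k), (q, k)) \<in> rtrancl_on (J \<union> X) grid"
      using rel_reach[of p q] rel_reach[of q p] that sym rtrancl_on_symD[OF sym_grid]
      by (cases "p \<le> q") auto
  qed
qed

text \<open>A discrete intermediate value argument: inside one column each step changes the row by
  one, so the walk passes through every row between its ends.\<close>

lemma column_reach_between:
  assumes "X \<subseteq> column m k" "(u, v) \<in> rtrancl_on X grid" "w \<in> X"
    "fst u \<le> fst w \<and> fst w \<le> fst v \<or> fst v \<le> fst w \<and> fst w \<le> fst u"
  shows "(u, w) \<in> rtrancl_on X grid"
  using assms(2,4)
proof (induct rule: rtrancl_on_induct)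
  case base
  then have "snd u = k" "snd w = k" "fst w = fst u"
    using assms(1,3) mem_column_iff by (blast, blast, auto)
  then have "w = u" by (simp add: prod_eq_iff)
  then show ?case using base by auto
next
  case (step y z)
  have s: "snd y = k" "snd z = k" "snd w = k"
    using step(3,4) assms(1,3) mem_column_iff by blast+
  with step(2) have "fst z = fst y + 1 \<or> fst y = fst z + 1" by (auto simp: grid_def)
  then have "fst w = fst z \<or> fst u \<le> fst w \<and> fst w \<le> fst y \<or> fst y \<le> fst w \<and> fst w \<le> fst u"
    using step(6) by arith
  then consider "w = z" | "fst u \<le> fst w \<and> fst w \<le> fst y \<or> fst y \<le> fst w \<and> fst w \<le> fst u"
    using s prod_eqI by metis
  then show ?case
  proof cases
    case 1
    then show ?thesis using step by (blast intro: rtrancl_on_into_rtrancl_on)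
  next
    case 2
    then show ?thesis using step by blast
  qed
qed

text \<open>A numerical key: it both distinguishes the components of a column and orders
  them.\<close>

definition bottom :: "(nat \<times> nat) set \<Rightarrow> nat" where
  "bottom A = Min (fst ` A)"

section \<open>The order of the components within one column\<close>

context
  fixes m k :: nat and X :: "(nat \<times> nat) set"
  assumes X: "X \<subseteq> column m k"
begin

lemma component_column:
  assumes "A \<in> comps grid X"
  shows "A \<subseteq> X" "finite A" "(bottom A, k) \<in> A" "a \<in> A \<Longrightarrow> bottom A \<le> fst a"
proof -
  show A: "A \<subseteq> X" using comps_memberD(2)[OF sym_grid assms] by auto
  then show fin: "finite A" using X finite_subset[OF _ finite_column] by blast
  show "a \<in> A \<Longrightarrow> bottom A \<le> fst a" using fin by (simp add: bottom_def)
  have "bottom A \<in> fst ` A"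
    unfolding bottom_def using fin comps_nonempty[OF sym_grid assms] by (intro Min_in) auto
  then obtain a where "a \<in> A" "fst a = bottom A" by auto
  then show "(bottom A, k) \<in> A"
    using A X by (cases a) (auto simp: mem_column_iff)
qed

lemma inj_on_bottom: "inj_on bottom (comps grid X)"
proof (rule inj_onI)
  fix A B assume AB: "A \<in> comps grid X" "B \<in> comps grid X" "bottom A = bottom B"
  then have "(bottom A, k) \<in> A" "(bottom A, k) \<in> B"
    using component_column(3)[OF AB(1)] component_column(3)[OF AB(2)] by auto
  then show "A = B"
    using comps_memberD(1)[OF sym_grid AB(1)] comps_memberD(1)[OF sym_grid AB(2)] by metis
qed

text \<open>A vertex \<open>b\<close> of \<open>B\<close> not above some \<open>a\<close> in
  \<open>A\<close> would have its row between \<open>bottom A\<close> and that of \<open>a\<close>,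
  hence would belong to \<open>A\<close>.\<close>

lemma component_less_iff:
  assumes "A \<in> comps grid X" "B \<in> comps grid X"
  shows "(\<forall>a\<in>A. \<forall>b\<in>B. fst a < fst b) \<longleftrightarrow> bottom A < bottom B"
proof
  assume "\<forall>a\<in>A. \<forall>b\<in>B. fst a < fst b"
  then show "bottom A < bottom B"
    using component_column(3)[OF assms(1)] component_column(3)[OF assms(2)] by fastforce
next
  assume less: "bottom A < bottom B"
  show "\<forall>a\<in>A. \<forall>b\<in>B. fst a < fst b"
  proof (intro ballI, rule ccontr)
    fix a b assume a: "a \<in> A" and b: "b \<in> B" and "\<not> fst a < fst b"
    let ?u = "(bottom A, k)"
    have "(?u, a) \<in> rtrancl_on X grid"
      using comps_memberD(1)[OF sym_grid assms(1) component_column(3)[OF assms(1)]] a by auto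
    moreover have "fst ?u \<le> fst b" "fst b \<le> fst a"
      using less component_column(4)[OF assms(2) b] \<open>\<not> fst a < fst b\<close> by auto
    ultimately have "(?u, b) \<in> rtrancl_on X grid"
      using column_reach_between[OF X, of ?u a b] b component_column(1)[OF assms(2)] by blast
    then have "b \<in> A"
      using comps_memberD(1)[OF sym_grid assms(1) component_column(3)[OF assms(1)]] by auto
    then have "A = B"
      using b comps_memberD(1)[OF sym_grid assms(1), of b] comps_memberD(1)[OF sym_grid assms(2), of b] by simp
    then show False using less by simp
  qed
qed

text \<open>\<open>ordered_components\<close> is a definite description, so unique existence is
  needed first. The keys reduce it to the uniqueness of a strictly increasing list of numbers with a
  given set of entries.\<close>

lemma ordered_components_PP:
  assumes k: "1 \<le> k" "k \<le> n"
  defines "Rs \<equiv> ordered_components (PP m n) X"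
  shows "set Rs = comps grid X" "distinct Rs"
    "sorted_wrt (\<lambda>A B. \<forall>a\<in>A. \<forall>b\<in>B. fst a < fst b) Rs"
proof -
  let ?c = "comps grid X" and ?P = "\<lambda>A B. \<forall>a\<in>A. \<forall>b\<in>B. fst a < fst b"
  have comp: "components (PP m n \<restriction> X) = ?c"
    using X column_subset_box[OF k, of m] by (intro components_PP) auto
  have fin: "finite ?c" using X finite_subset[OF _ finite_column] by (blast intro: finite_comps)
  have sorted_iff: "sorted_wrt ?P Rs \<longleftrightarrow> sorted_wrt (<) (map bottom Rs)" if "set Rs = ?c" for Rs
    using that component_less_iff unfolding sorted_wrt_map by (intro iffI; elim sorted_wrt_mono_rel[rotated]; auto)
  \<comment> \<open>The witness: sort the keys, then return from keys to components.\<close>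
  define Qs where "Qs = map (inv_into ?c bottom) (sorted_list_of_set (bottom ` ?c))"
  have Q: "set Qs = ?c" "map bottom Qs = sorted_list_of_set (bottom ` ?c)"
    using fin by (auto simp: Qs_def inv_into_image_cancel[OF inj_on_bottom] f_inv_into_f cong: map_cong
        intro!: map_idI simp: comp_def)
  have "\<exists>!Rs. set Rs = components (PP m n \<restriction> X) \<and> sorted_wrt ?P Rs"
  proof (rule ex1I[of _ Qs])
    show "set Qs = components (PP m n \<restriction> X) \<and> sorted_wrt ?P Qs"
      using Q sorted_iff[of Qs] by (simp add: comp)
    fix Rs assume "set Rs = components (PP m n \<restriction> X) \<and> sorted_wrt ?P Rs"
    then have R: "set Rs = ?c" and "sorted_wrt ?P Rs" by (simp_all only: comp)
    then have s: "sorted_wrt (<) (map bottom Rs)" using sorted_iff[of Rs] by blast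
    have "set (map bottom Rs) = bottom ` ?c" by (simp only: set_map R)
    then have "map bottom Rs = map bottom Qs"
      using s fin unfolding Q(2)
      by (intro sorted_distinct_set_unique) (simp_all add: strict_sorted_iff)
    moreover have "inj_on bottom (set Rs \<union> set Qs)"
      using inj_on_bottom R Q(1) by simp
    ultimately show "Rs = Qs" by (rule map_inj_on)
  qed
  from theI'[OF this] have R: "set Rs = ?c" "sorted_wrt ?P Rs"
    by (simp_all add: Rs_def ordered_components_def comp)
  then show "set Rs = ?c" "sorted_wrt ?P Rs" by auto
  show "distinct Rs"
    using sorted_iff[OF R(1)] R(2) by (auto simp: strict_sorted_iff distinct_map)
qed

lemma card_components_column_le:
  assumes "m \<le> 4"
  shows "card (comps grid X) \<le> 2"
proof -
  \<comment> \<open>The map pairs the rows as 1, 2 and 3, 4. Two components never have consecutive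
    lowest rows, since those vertices would be adjacent, so no pair is hit twice.\<close>
  let ?h = "\<lambda>A. (bottom A + 1) div 2"
  have far: "bottom B \<noteq> bottom A + 1" if "A \<in> comps grid X" "B \<in> comps grid X" for A B
  proof
    assume *: "bottom B = bottom A + 1"
    note a = component_column(3)[OF that(1)] and b = component_column(3)[OF that(2)]
    have "((bottom A, k), (bottom B, k)) \<in> rtrancl_on X grid"
      using * a b component_column(1)[OF that(1)] component_column(1)[OF that(2)]
      by (intro rtrancl_on_edge) (auto simp: grid_def)
    then have "(bottom B, k) \<in> A" using comps_memberD(1)[OF sym_grid that(1) a] by auto
    then have "A = B"
      using comps_memberD(1)[OF sym_grid that(1)] comps_memberD(1)[OF sym_grid that(2)] b by metis
    with * show False by simp
  qed
  have range: "1 \<le> bottom A \<and> bottom A \<le> m" if "A \<in> comps grid X" for A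
    using component_column(1,3)[OF that] X by (auto simp: mem_column_iff subset_iff)
  have "inj_on ?h (comps grid X)"
  proof (rule inj_onI)
    fix A B assume AB: "A \<in> comps grid X" "B \<in> comps grid X" "?h A = ?h B"
    have half: "a = b" if "(a + 1) div 2 = (b + 1) div 2" "b \<noteq> a + 1" "a \<noteq> b + 1" for a b :: nat
      using that by presburger
    have "bottom A = bottom B"
      by (rule half[OF AB(3) far[OF AB(1,2)] far[OF AB(2,1)]])
    then show "A = B" using AB inj_on_bottom by (auto dest: inj_onD)
  qed
  moreover have "?h ` comps grid X \<subseteq> {1, 2}"
    using range assms by (fastforce simp: image_subset_iff)
  ultimately have "card (comps grid X) \<le> card {1, 2 :: nat}"
    by (intro card_inj_on_le) auto
  then show ?thesis by simp
qed

section \<open>Rows of column \<open>k\<close> joined by a set to its right\<close>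

context
  fixes n :: nat and W :: "(nat \<times> nat) set"
  assumes k: "1 \<le> k" "k \<le> n" and W: "W \<subseteq> box m n" "\<And>w. w \<in> W \<Longrightarrow> k < snd w"
begin

text \<open>The component of \<open>W \<union> X\<close> containing \<open>R\<close> is the class of
  any single vertex \<open>x\<close> of \<open>R\<close>, which turns \<open>comp_rows\<close> into
  a reachability statement.\<close>

lemma comp_rows_eq:
  assumes "R \<in> comps grid X" "x \<in> R"
  shows "comp_rows (PP m n) (W \<union> X) k R = {q. (x, (q, k)) \<in> rtrancl_on (W \<union> X) grid}"
proof -
  have sub: "W \<union> X \<subseteq> box m n" using W X column_subset_box[OF k, of m] by auto
  have x: "x \<in> X" using component_column(1)[OF assms(1)] assms(2) by auto
  have "R \<subseteq> D \<longleftrightarrow> D = rtrancl_on (W \<union> X) grid `` {x}" if "D \<in> comps grid (W \<union> X)" for D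
  proof
    assume "R \<subseteq> D"
    then show "D = rtrancl_on (W \<union> X) grid `` {x}"
      using comps_memberD(1)[OF sym_grid that, of x] assms(2) by auto
  next
    assume "D = rtrancl_on (W \<union> X) grid `` {x}"
    then show "R \<subseteq> D"
      using comps_memberD(1)[OF sym_grid assms] rtrancl_on_subset[of X "W \<union> X"] by blast
  qed
  then show ?thesis
    using compsI[of x "W \<union> X" grid] x unfolding comp_rows_def components_PP[OF sub] by auto
qed

lemma comp_rows_subset:
  assumes "R \<in> comps grid X" "q \<in> comp_rows (PP m n) (W \<union> X) k R"
  shows "(q, k) \<in> X"
proof -
  obtain x where "x \<in> R" using comps_nonempty[OF sym_grid assms(1)] by auto
  with assms have "(q, k) \<in> W \<union> X" using comp_rows_eq by (auto dest: in_rtrancl_on_in_F)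
  then show ?thesis using W(2)[of "(q, k)"] by auto
qed

lemma l_low_high:
  assumes "R \<in> comps grid X"
  defines "rows \<equiv> comp_rows (PP m n) (W \<union> X) k R"
  shows "l_low (PP m n) (W \<union> X) k R \<in> rows" "l_high (PP m n) (W \<union> X) k R \<in> rows"
    "q \<in> rows \<Longrightarrow> l_low (PP m n) (W \<union> X) k R \<le> q" "q \<in> rows \<Longrightarrow> q \<le> l_high (PP m n) (W \<union> X) k R"
proof -
  have fin: "finite rows"
  proof (rule finite_subset)
    show "rows \<subseteq> fst ` X"
      using comp_rows_subset[OF assms(1)] unfolding rows_def by force
    show "finite (fst ` X)"
      using X finite_column finite_subset by blast
  qed
  obtain x where x: "x \<in> R" using comps_nonempty[OF sym_grid assms(1)] by auto
  then have "x \<in> X" using component_column(1)[OF assms(1)] by auto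
  then have "x = (fst x, k)"
    using X by (metis mem_column_iff prod.collapse subsetD)
  then have "(x, (fst x, k)) \<in> rtrancl_on (W \<union> X) grid"
    using \<open>x \<in> X\<close> by (metis Un_iff rtrancl_on_refl)
  then have ne: "rows \<noteq> {}"
    unfolding rows_def using comp_rows_eq[OF assms(1) x] by blast
  show "l_low (PP m n) (W \<union> X) k R \<in> rows" "l_high (PP m n) (W \<union> X) k R \<in> rows"
    "q \<in> rows \<Longrightarrow> l_low (PP m n) (W \<union> X) k R \<le> q" "q \<in> rows \<Longrightarrow> q \<le> l_high (PP m n) (W \<union> X) k R"
    using fin ne unfolding l_low_def l_high_def rows_def by auto
qed

definition "row_rel p q \<longleftrightarrow> ((p, k), (q, k)) \<in> rtrancl_on (W \<union> X) grid"

definition "rows = {p. (p, k) \<in> X}"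

lemma X_rows: "X = rows \<times> {k}"
  using X by (auto simp: rows_def mem_column_iff)

text \<open>Brings \<open>hull_set\<close> into the form required by
  \<open>hull_reachability\<close>: the extreme rows of a class are themselves a related pair, and
  every related pair lies between the extremes of its class.\<close>

lemma hull_set_eq:
  "hull_set (PP m n) (W \<union> X) k X
    = {q. \<exists>p1\<in>rows. \<exists>p2\<in>rows. row_rel p1 p2 \<and> p1 \<le> q \<and> q \<le> p2} \<times> {k + 1}" (is "?H = ?J")
proof -
  have comp: "components (PP m n \<restriction> X) = comps grid X"
    using X column_subset_box[OF k, of m] by (intro components_PP) auto
  show ?thesis
  proof (intro set_eqI iffI)
    fix v assume "v \<in> ?H"
    then obtain q R where v: "v = (q, k + 1)" and R: "R \<in> comps grid X"
      and q: "l_low (PP m n) (W \<union> X) k R \<le> q" "q \<le> l_high (PP m n) (W \<union> X) k R"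
      by (auto simp: hull_set_def comp)
    obtain x where x: "x \<in> R" using comps_nonempty[OF sym_grid R] by auto
    let ?l = "l_low (PP m n) (W \<union> X) k R" and ?h = "l_high (PP m n) (W \<union> X) k R"
    have "row_rel ?l ?h"
      using l_low_high(1,2)[OF R] unfolding comp_rows_eq[OF R x] row_rel_def
      by (auto intro: rtrancl_on_trans rtrancl_on_symD[OF sym_grid])
    moreover have "?l \<in> rows" "?h \<in> rows"
      using l_low_high(1,2)[OF R] comp_rows_subset[OF R] by (auto simp: rows_def)
    ultimately show "v \<in> ?J" using q v by auto
  next
    fix v assume "v \<in> ?J"
    then obtain q p1 p2 where v: "v = (q, k + 1)" and p: "p1 \<in> rows" "row_rel p1 p2" "p1 \<le> q" "q \<le> p2"
      by auto
    let ?R = "rtrancl_on X grid `` {(p1, k)}"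
    have R: "?R \<in> comps grid X" and x: "(p1, k) \<in> ?R"
      using p(1) compsI[of "(p1, k)" X grid] by (auto simp: rows_def)
    have "p1 \<in> comp_rows (PP m n) (W \<union> X) k ?R" "p2 \<in> comp_rows (PP m n) (W \<union> X) k ?R"
      using p unfolding comp_rows_eq[OF R x] by (auto simp: row_rel_def rows_def)
    then have "l_low (PP m n) (W \<union> X) k ?R \<le> q" "q \<le> l_high (PP m n) (W \<union> X) k ?R"
      using l_low_high(3,4)[OF R] p by (meson le_trans)+
    then show "v \<in> ?H" using v R by (auto simp: hull_set_def comp)
  qed
qed

text \<open>The lowest row \<open>l i\<close> of a class belongs to that class, so equal values of
  \<open>l\<close> mean equal classes. Positions in the list increase with rows, which turns the
  condition on indices into convexity of rows.\<close>

lemma consecutive_groups_convex: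
  assumes "consecutive_groups (PP m n) (W \<union> X) k X"
    and p: "p \<in> rows" and q: "q \<in> rows" and r: "r \<in> rows" and le: "p \<le> q" "q \<le> r" and rel: "row_rel p r"
  shows "row_rel p q"
proof -
  define Rs where "Rs = ordered_components (PP m n) X"
  define l where "l i = l_low (PP m n) (W \<union> X) k (Rs ! i)" for i
  note Rs = ordered_components_PP[OF k, folded Rs_def]
  have idx: "\<exists>i<length Rs. (a, k) \<in> Rs ! i" if "a \<in> rows" for a
  proof -
    have "(a, k) \<in> X" using that by (simp add: rows_def)
    then have "rtrancl_on X grid `` {(a, k)} \<in> set Rs" "(a, k) \<in> rtrancl_on X grid `` {(a, k)}"
      using compsI[of "(a, k)" X grid] Rs(1) by auto
    then show ?thesis by (metis in_set_conv_nth)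
  qed
  obtain i1 where i1: "i1 < length Rs" "(p, k) \<in> Rs ! i1" using idx p by blast
  obtain i2 where i2: "i2 < length Rs" "(r, k) \<in> Rs ! i2" using idx r by blast
  obtain i3 where i3: "i3 < length Rs" "(q, k) \<in> Rs ! i3" using idx q by blast
  have mono: "i \<le> j"
    if "i < length Rs" "j < length Rs" "(a, k) \<in> Rs ! i" "(b, k) \<in> Rs ! j" "a \<le> b" for i j a b
  proof (rule ccontr)
    assume "\<not> i \<le> j"
    then have "\<forall>a\<in>Rs ! j. \<forall>b\<in>Rs ! i. fst a < fst b"
      using Rs(3) that(1) unfolding sorted_wrt_iff_nth_less by (meson not_le)
    then have "fst (b, k) < fst (a, k)" using that(3,4) by blast
    then show False using that(5) by simp
  qed
  have comp: "Rs ! i \<in> comps grid X" if "i < length Rs" for i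
    using that Rs(1) nth_mem by blast
  have "l i1 = l i2"
  proof -
    have "comp_rows (PP m n) (W \<union> X) k (Rs ! i1) = comp_rows (PP m n) (W \<union> X) k (Rs ! i2)"
      unfolding comp_rows_eq[OF comp[OF i1(1)] i1(2)] comp_rows_eq[OF comp[OF i2(1)] i2(2)]
      using rel by (auto simp: row_rel_def intro: rtrancl_on_trans rtrancl_on_symD[OF sym_grid])
    then show ?thesis by (simp add: l_def l_low_def)
  qed
  moreover have "i1 \<le> i3" "i3 \<le> i2" using mono i1 i2 i3 le by blast+
  ultimately have "l i3 = l i1"
    using assms(1) i2 unfolding consecutive_groups_def Let_def Rs_def[symmetric] l_def[symmetric]
    by (meson le_trans)
  moreover have "((p, k), (l i1, k)) \<in> rtrancl_on (W \<union> X) grid"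
    using l_low_high(1)[OF comp[OF i1(1)]] unfolding comp_rows_eq[OF comp[OF i1(1)] i1(2)] l_def by simp
  moreover have "((q, k), (l i3, k)) \<in> rtrancl_on (W \<union> X) grid"
    using l_low_high(1)[OF comp[OF i3(1)]] unfolding comp_rows_eq[OF comp[OF i3(1)] i3(2)] l_def by simp
  ultimately show ?thesis
    unfolding row_rel_def by (metis rtrancl_on_trans rtrancl_on_symD[OF sym_grid])
qed

text \<open>With at most two components no index lies strictly between two others.\<close>

lemma consecutive_groups_le_4:
  assumes "m \<le> 4"
  shows "consecutive_groups (PP m n) (W \<union> X) k X"
proof -
  define Rs where "Rs = ordered_components (PP m n) X"
  have "length Rs \<le> 2"
    using ordered_components_PP[OF k, folded Rs_def] card_components_column_le[OF assms]
    by (metis distinct_card)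
  then have two: "i3 = i1 \<or> i3 = i2" if "i1 \<le> i3" "i3 \<le> i2" "i2 < length Rs" for i1 i2 i3
    using that by linarith
  show ?thesis
    unfolding consecutive_groups_def Let_def Rs_def[symmetric]
    using two by (metis order_refl)
qed

lemma hull_set_subset: "hull_set (PP m n) (W \<union> X) k X \<subseteq> column m (k + 1)"
proof -
  have "1 \<le> p \<and> p \<le> m" if "p \<in> rows" for p
  proof -
    have "(p, k) \<in> column m k" using that X by (auto simp only: rows_def mem_Collect_eq)
    then show ?thesis by (simp add: mem_column_iff)
  qed
  then show ?thesis
    unfolding hull_set_eq by (fastforce simp: mem_column_iff)
qed

text \<open>Each row of \<open>X\<close> is related to itself and so reappears in the hull. This
  makes the pair of the hull and \<open>X\<close> admissible as arguments of
  \<open>L2\<close>.\<close>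

lemma hull_set_prev:
  assumes "X \<noteq> {}"
  shows "X \<inter> prev_col m (k + 1) (hull_set (PP m n) (W \<union> X) k X) \<noteq> {}"
proof -
  obtain p where p: "p \<in> rows" using assms X_rows by auto
  then have "row_rel p p" by (simp add: row_rel_def rows_def)
  with p have "(p, k + 1) \<in> hull_set (PP m n) (W \<union> X) k X" unfolding hull_set_eq by auto
  then have "(p, k) \<in> X \<inter> prev_col m (k + 1) (hull_set (PP m n) (W \<union> X) k X)"
    using p unfolding prev_col_eq[OF hull_set_subset k(1)] by (auto simp: rows_def)
  then show ?thesis by blast
qed

lemma hull_set_reachability:
  assumes "consecutive_groups (PP m n) (W \<union> X) k X"
  defines "J \<equiv> hull_set (PP m n) (W \<union> X) k X"
  shows "x \<in> X \<Longrightarrow> y \<in> X \<Longrightarrow> (x, y) \<in> rtrancl_on (W \<union> X) grid \<longleftrightarrow> (x, y) \<in> rtrancl_on (J \<union> X) grid"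
    and "w \<in> J \<Longrightarrow> \<exists>x\<in>X. (w, x) \<in> rtrancl_on (J \<union> X) grid"
proof -
  have refl: "row_rel p p" if "p \<in> rows" for p
    using that by (simp add: row_rel_def rows_def)
  have sym: "row_rel p q \<Longrightarrow> row_rel q p" for p q
    unfolding row_rel_def by (rule rtrancl_on_symD[OF sym_grid])
  have trans: "row_rel p q \<Longrightarrow> row_rel q r \<Longrightarrow> row_rel p r" for p q r
    unfolding row_rel_def by (rule rtrancl_on_trans)
  have edge: "row_rel p (p + 1)" if "p \<in> rows" "p + 1 \<in> rows" for p
    using that unfolding row_rel_def rows_def by (intro rtrancl_on_edge) (auto simp: grid_def)
  note convex = consecutive_groups_convex[OF assms(1)]
  note hull = hull_reachability[where P = rows and rel = row_rel and k = k, folded hull_set_eq X_rows, folded J_def]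
  show "\<exists>x\<in>X. (w, x) \<in> rtrancl_on (J \<union> X) grid" if "w \<in> J"
    using that by (intro hull(2); blast intro: refl sym trans edge convex)
  show "(x, y) \<in> rtrancl_on (W \<union> X) grid \<longleftrightarrow> (x, y) \<in> rtrancl_on (J \<union> X) grid" if "x \<in> X" "y \<in> X"
  proof -
    have "x \<in> rows \<times> {k}" "y \<in> rows \<times> {k}"
      using that X_rows by blast+
    then obtain p q where pq: "x = (p, k)" "y = (q, k)" "p \<in> rows" "q \<in> rows"
      by blast
    have "(x, y) \<in> rtrancl_on (J \<union> X) grid \<longleftrightarrow> row_rel p q"
      unfolding pq(1,2) using pq(3,4)
      by (intro hull(1); blast intro: refl sym trans edge convex)
    then show ?thesis unfolding pq(1,2) row_rel_def by simp
  qed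
qed

end

end

section \<open>The recursive lower bound\<close>

text \<open>The context touches \<open>C\<close> only in column \<open>X\<close>, so a component of
  \<open>W\<close> that survives in \<open>W \<union> X\<close> is cut off for good. Every full set
  ending in \<open>X\<close> then counts, whence the value \<open>N_fix\<close>.\<close>

lemma defective_isolated:
  assumes "X \<subseteq> column m k" "X \<noteq> {}" and W: "\<And>w. w \<in> W \<Longrightarrow> k < snd w"
    and common: "comps grid W \<inter> comps grid (W \<union> X) \<noteq> {}"
  shows "defective m k X W = {C \<in> full_sets m k. C \<inter> column m k = X}"
proof -
  obtain D where D: "D \<in> comps grid W" "D \<in> comps grid (W \<union> X)" using common by blast
  have "\<not> conn grid (C \<union> W)" if C: "C \<in> full_sets m k" "C \<inter> column m k = X" for C
  proof (rule isolated_component_not_conn[OF sym_grid D])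
    show "v \<in> X" if "u \<in> W" "v \<in> C" "(u, v) \<in> grid" for u v
      using that W[of u] subsetD[OF full_sets_subset[OF C(1)], of v] C(2)
      by (cases u; cases v) (auto simp: grid_def mem_box_iff mem_column_iff)
    show "C \<noteq> {}" using C assms(2) by auto
    show "C \<inter> W = {}"
      using W full_sets_subset[OF C(1)] by (fastforce simp: mem_box_iff)
  qed
  then show ?thesis by (auto simp: defective_def)
qed

text \<open>Both contexts lie strictly to the right of column \<open>k\<close>, so only the
  interface \<open>X\<close> can be adjacent to them, and only the relation that they induce on
  \<open>X\<close> matters.\<close>

lemma defective_replace:
  assumes "X \<noteq> {}" and W: "\<And>w. w \<in> W \<Longrightarrow> k < snd w" "\<And>w. w \<in> W' \<Longrightarrow> k < snd w"
    and meets: "\<And>w. w \<in> W \<Longrightarrow> \<exists>x\<in>X. (w, x) \<in> rtrancl_on (W \<union> X) grid"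
      "\<And>w. w \<in> W' \<Longrightarrow> \<exists>x\<in>X. (w, x) \<in> rtrancl_on (W' \<union> X) grid"
    and same: "\<And>x y. x \<in> X \<Longrightarrow> y \<in> X \<Longrightarrow> (x, y) \<in> rtrancl_on (W \<union> X) grid
           \<longleftrightarrow> (x, y) \<in> rtrancl_on (W' \<union> X) grid"
  shows "defective m k X W = defective m k X W'"
proof -
  have "conn grid (C \<union> W) \<longleftrightarrow> conn grid (C \<union> W')" if C: "C \<in> full_sets m k" "C \<inter> column m k = X" for C
  proof (rule conn_replace_iff[OF sym_grid _ _ _ _ _ _ meets same])
    show "C \<noteq> {}" "X \<subseteq> C" using C(2) assms(1) by auto
    show "C \<inter> W = {}" "C \<inter> W' = {}"
      using W full_sets_subset[OF C(1)] by (fastforce simp: mem_box_iff)+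
    show "u \<in> X" if "u \<in> C" "v \<in> W" "(u, v) \<in> grid" for u v
      using that W(1)[of v] subsetD[OF full_sets_subset[OF C(1)], of u] C(2)
      by (cases u; cases v) (auto simp: grid_def mem_box_iff mem_column_iff)
    show "u \<in> X" if "u \<in> C" "v \<in> W'" "(u, v) \<in> grid" for u v
      using that W(2)[of v] subsetD[OF full_sets_subset[OF C(1)], of u] C(2)
      by (cases u; cases v) (auto simp: grid_def mem_box_iff mem_column_iff)
  qed
  then show ?thesis by (auto simp: defective_def)
qed

text \<open>The case of an empty replacement: equal component counts say that reachability on
  \<open>X\<close> through \<open>W\<close> is the same as within \<open>X\<close>.\<close>

lemma defective_no_merge:
  assumes X: "X \<subseteq> column m k" "X \<noteq> {}" and W: "\<And>w. w \<in> W \<Longrightarrow> k < snd w"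
    and common: "comps grid W \<inter> comps grid (W \<union> X) = {}"
    and card: "card (comps grid (W \<union> X)) = card (comps grid X)"
  shows "defective m k X W = defective m k X {}"
proof (rule defective_replace[OF X(2) W])
  note meets = no_common_component_meets[OF sym_grid common]
  show "\<exists>x\<in>X. (w, x) \<in> rtrancl_on (W \<union> X) grid" if "w \<in> W" for w
    using meets[OF that] .
  have fin: "finite X" using X finite_column finite_subset by blast
  show "(x, y) \<in> rtrancl_on (W \<union> X) grid \<longleftrightarrow> (x, y) \<in> rtrancl_on ({} \<union> X) grid"
    if "x \<in> X" "y \<in> X" for x y
  proof
    assume "(x, y) \<in> rtrancl_on (W \<union> X) grid"
    then show "(x, y) \<in> rtrancl_on ({} \<union> X) grid"
      using card_comps_union_eqD[OF sym_grid fin meets card that] by simp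
  next
    assume "(x, y) \<in> rtrancl_on ({} \<union> X) grid"
    then show "(x, y) \<in> rtrancl_on (W \<union> X) grid"
      using rtrancl_on_subset[of X "W \<union> X"] by auto
  qed
qed auto

text \<open>The lower bound is exact as soon as no column has room for three components, i.e. for \<open>m \<le> 4\<close>.\<close>

definition estimates :: "nat \<Rightarrow> nat \<Rightarrow> nat \<Rightarrow> bool" where
  "estimates m a b \<longleftrightarrow> a \<le> b \<and> (m \<le> 4 \<longrightarrow> a = b)"

lemma estimates_refl: "a = b \<Longrightarrow> estimates m a b"
  by (simp add: estimates_def)

lemma estimates_sum:
  "(\<And>x. x \<in> A \<Longrightarrow> estimates m (f x) (g x)) \<Longrightarrow> estimates m (sum f A) (sum g A)"
  by (auto simp: estimates_def intro: sum_mono sum.cong)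

section \<open>Comparison of the recursion with the exact count\<close>

lemma L1_estimates_step:
  assumes n: "1 \<le> n" and S: "S \<noteq> {}" "S \<subseteq> column m n"
    and L2: "\<And>T. 3 \<le> n \<Longrightarrow> T \<subseteq> column m (n - 1) \<Longrightarrow> T \<inter> prev_col m n S \<noteq> {}
      \<Longrightarrow> estimates m (L2 m n S T) (card (defective m (n - 1) T S))"
  shows "estimates m (L1 m n S) (card (defective m n S {}))"
proof (cases "n \<le> 2")
  case True
  then show ?thesis
    using N_fix'_eq[OF S(2,1) n] by (simp add: L1.simps estimates_refl)
next
  case False
  then have "card (defective m n S {})
      = (\<Sum>T | T \<subseteq> column m (n - 1) \<and> T \<inter> prev_col m n S \<noteq> {}. card (defective m (n - 1) T S))"
    using card_defective_Suc[of "n - 1" S m "{}"] S by simp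
  then show ?thesis
    using False L2 by (auto simp: L1.simps intro!: estimates_sum)
qed

text \<open>The case distinction is met twice, first with interface \<open>T\<close> and context
  \<open>S\<close>, then, if \<open>S\<close> merges components of \<open>T\<close>, with interface
  \<open>X\<close> and context \<open>S \<union> T\<close>. In the last case the hull
  \<open>J\<close> takes the place of the context, which brings it back to one column and to
  \<open>L2\<close> at \<open>n - 1\<close>.\<close>

lemma L2_estimates_step:
  assumes n: "2 \<le> n" and S: "S \<subseteq> column m n"
    and T: "T \<subseteq> column m (n - 1)" "T \<inter> prev_col m n S \<noteq> {}"
    and L1: "\<And>k U. k < n \<Longrightarrow> 1 \<le> k \<Longrightarrow> U \<noteq> {} \<Longrightarrow> U \<subseteq> column m k
      \<Longrightarrow> estimates m (L1 m k U) (card (defective m k U {}))"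
    and L2: "\<And>J X. 3 \<le> n \<Longrightarrow> J \<subseteq> column m (n - 1) \<Longrightarrow> X \<subseteq> column m (n - 2)
      \<Longrightarrow> X \<inter> prev_col m (n - 1) J \<noteq> {}
      \<Longrightarrow> estimates m (L2 m (n - 1) J X) (card (defective m (n - 2) X J))"
  shows "estimates m (L2 m n S T) (card (defective m (n - 1) T S))"
proof (cases "n = 2")
  case True
  then show ?thesis
    using N_fix'_two_columns[of 1 S m T] S T by (simp add: L2.simps estimates_refl numeral_2_eq_2)
next
  case False
  with n have n3: "3 \<le> n" by simp
  have T_ne: "T \<noteq> {}" using T by auto
  have S_above: "n - 1 < snd w" if "w \<in> S" for w
    using that S n3 by (auto simp: mem_column_iff dest!: subsetD)
  have W_above: "n - 2 < snd w" if "w \<in> S \<union> T" for w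
    using that S T(1) n3 by (auto simp: mem_column_iff dest!: subsetD)
  have "column m n \<subseteq> box m n" "column m (n - 1) \<subseteq> box m n"
    using n3 by (intro column_subset_box; simp)+
  then have S_box: "S \<subseteq> box m n" and T_box: "T \<subseteq> box m n"
    using S T(1) by blast+
  have comps_S: "components (PP m n \<restriction> S) = comps grid S"
    and comps_T: "components (PP m n \<restriction> T) = comps grid T"
    and comps_ST: "components (PP m n \<restriction> (S \<union> T)) = comps grid (S \<union> T)"
    using S_box T_box by (auto intro!: components_PP)
  define summand where "summand X =
         (if components (PP m n \<restriction> (S \<union> T)) \<inter> components (PP m n \<restriction> (S \<union> T \<union> X)) \<noteq> {}
             then N_fix m (n - 2) X
           else if num_components (PP m n \<restriction> (S \<union> T \<union> X)) = num_components (PP m n \<restriction> X)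
             then L1 m (n - 2) X
           else if num_components (PP m n \<restriction> (S \<union> T \<union> X)) < num_components (PP m n \<restriction> X)
                \<and> consecutive_groups (PP m n) (S \<union> T \<union> X) (n - 2) X
             then L2 m (n - 1) (hull_set (PP m n) (S \<union> T \<union> X) (n - 2) X) X
           else 0)" for X
  have L2_eq: "L2 m n S T =
      (if comps grid S \<inter> comps grid (S \<union> T) \<noteq> {} then N_fix m (n - 1) T
       else if card (comps grid (S \<union> T)) = card (comps grid T) then L1 m (n - 1) T
       else if card (comps grid (S \<union> T)) < card (comps grid T)
         then \<Sum>X | X \<subseteq> column m (n - 2) \<and> X \<inter> prev_col m (n - 1) T \<noteq> {}. summand X
       else 0)"
    using n3 unfolding L2.simps[of m n S T] summand_def num_components_def comps_S comps_T comps_ST by simp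
  have summand: "estimates m (summand X) (card (defective m (n - 2) X (S \<union> T)))"
    if X: "X \<subseteq> column m (n - 2)" "X \<inter> prev_col m (n - 1) T \<noteq> {}" for X
  proof -
    let ?W = "S \<union> T" and ?k = "n - 2"
    have k: "1 \<le> ?k" "?k \<le> n" "?k < n" "?k + 1 = n - 1" using n3 by auto
    have X_ne: "X \<noteq> {}" using X by auto
    have fin: "finite X" using X(1) finite_column finite_subset by blast
    have W_box: "?W \<subseteq> box m n" using S_box T_box by simp
    have X_box: "X \<subseteq> box m n" using X(1) column_subset_box[OF k(1,2)] by blast
    have cX: "components (PP m n \<restriction> X) = comps grid X"
      and cWX: "components (PP m n \<restriction> (?W \<union> X)) = comps grid (?W \<union> X)"
      using X_box W_box by (auto intro!: components_PP)
    have summand_eq: "summand X =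
        (if comps grid ?W \<inter> comps grid (?W \<union> X) \<noteq> {} then N_fix m ?k X
         else if card (comps grid (?W \<union> X)) = card (comps grid X) then L1 m ?k X
         else if card (comps grid (?W \<union> X)) < card (comps grid X)
              \<and> consecutive_groups (PP m n) (?W \<union> X) ?k X
           then L2 m (n - 1) (hull_set (PP m n) (?W \<union> X) ?k X) X
         else 0)"
      unfolding summand_def num_components_def comps_ST cX cWX ..
    show ?thesis
    proof (cases "comps grid ?W \<inter> comps grid (?W \<union> X) = {}")
      case False
      then show ?thesis
        using defective_isolated[OF X(1) X_ne W_above False] N_fix_eq[OF X(1) X_ne k(1)]
        by (simp add: summand_eq estimates_refl)
    next
      case common: True
      note meets = no_common_component_meets[OF sym_grid common]
      show ?thesis
      proof (cases "card (comps grid (?W \<union> X)) = card (comps grid X)")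
        case True
        then show ?thesis
          using defective_no_merge[OF X(1) X_ne W_above common True] L1[OF k(3,1) X_ne X(1)] common
          by (simp add: summand_eq)
      next
        case False
        then have less: "card (comps grid (?W \<union> X)) < card (comps grid X)"
          using card_comps_union_le[OF sym_grid fin meets] by simp
        show ?thesis
        proof (cases "consecutive_groups (PP m n) (?W \<union> X) ?k X")
          case True
          let ?J = "hull_set (PP m n) (?W \<union> X) ?k X"
          note hull_args = X(1) k(1,2) W_box W_above
          have J: "?J \<subseteq> column m (n - 1)" "X \<inter> prev_col m (n - 1) ?J \<noteq> {}"
            using hull_set_subset[OF hull_args] hull_set_prev[OF hull_args X_ne] k(4) by simp_all
          have "defective m ?k X ?W = defective m ?k X ?J"
          proof (rule defective_replace[OF X_ne W_above _ meets])
            show "?k < snd w" if "w \<in> ?J" for w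
              using subsetD[OF J(1) that] n3 by (auto simp: mem_column_iff)
            show "\<exists>x\<in>X. (w, x) \<in> rtrancl_on (?J \<union> X) grid" if "w \<in> ?J" for w
              using hull_set_reachability(2)[OF hull_args True that] .
            show "(x, y) \<in> rtrancl_on (?W \<union> X) grid \<longleftrightarrow> (x, y) \<in> rtrancl_on (?J \<union> X) grid"
              if "x \<in> X" "y \<in> X" for x y
              using hull_set_reachability(1)[OF hull_args True that] .
          qed
          then show ?thesis
            using L2[OF n3 J(1) X(1) J(2)] common less True by (simp add: summand_eq)
        next
          \<comment> \<open>The one case settled neither by an equality nor by induction: the
            summand is 0, a lower bound that may fail to be exact. It is excluded for
            \<open>m \<le> 4\<close>.\<close>
          case nc: False
          then have "\<not> m \<le> 4"
            using consecutive_groups_le_4[OF X(1) k(1,2) W_box W_above] by blast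
          then show ?thesis
            using nc common less by (simp add: summand_eq estimates_def)
        qed
      qed
    qed
  qed
  have k: "1 \<le> n - 1" "n - 1 < n" "n - 2 + 1 = n - 1" "1 \<le> n - 2" using n3 by auto
  show ?thesis
  proof (cases "comps grid S \<inter> comps grid (S \<union> T) = {}")
    case False
    then show ?thesis
      using defective_isolated[OF T(1) T_ne S_above False] N_fix_eq[OF T(1) T_ne k(1)]
      by (simp add: L2_eq estimates_refl)
  next
    case common: True
    show ?thesis
    proof (cases "card (comps grid (S \<union> T)) = card (comps grid T)")
      case True
      then show ?thesis
        using defective_no_merge[OF T(1) T_ne S_above common True] L1[OF k(2,1) T_ne T(1)] common
        by (simp add: L2_eq)
    next
      case False
      have "finite T" using T(1) finite_column finite_subset by blast
      \<comment> \<open>Adding a context without isolated components cannot increase the number of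
        components, so the final \<open>else 0\<close> of \<open>L2\<close> is never
        reached.\<close>
      then have less: "card (comps grid (S \<union> T)) < card (comps grid T)"
        using card_comps_union_le[OF sym_grid _ no_common_component_meets[OF sym_grid common]] False by simp
      have "card (defective m (n - 1) T S)
        = (\<Sum>X | X \<subseteq> column m (n - 2) \<and> X \<inter> prev_col m (n - 1) T \<noteq> {}. card (defective m (n - 2) X (S \<union> T)))"
        using card_defective_Suc[OF k(4), of T m S] T(1) unfolding k(3) by (simp add: Un_commute)
      then show ?thesis
        using common less summand by (auto simp: L2_eq intro!: estimates_sum)
    qed
  qed
qed

text \<open>Both estimates are proved together. At a given \<open>n\<close> the one for
  \<open>L2\<close> comes first, as it needs smaller values only, while \<open>L1\<close> at
  \<open>n\<close> refers to \<open>L2\<close> at the same \<open>n\<close>.\<close>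

lemma L_estimates:
  "(1 \<le> n \<longrightarrow> (\<forall>S. S \<noteq> {} \<longrightarrow> S \<subseteq> column m n \<longrightarrow> estimates m (L1 m n S) (card (defective m n S {})))) \<and>
   (2 \<le> n \<longrightarrow> (\<forall>S T. S \<subseteq> column m n \<longrightarrow> T \<subseteq> column m (n - 1) \<longrightarrow> T \<inter> prev_col m n S \<noteq> {} \<longrightarrow>
      estimates m (L2 m n S T) (card (defective m (n - 1) T S))))"
proof (induct n rule: less_induct)
  case (less n)
  have L1: "estimates m (L1 m k U) (card (defective m k U {}))"
    if "k < n" "1 \<le> k" "U \<noteq> {}" "U \<subseteq> column m k" for k U
    using less[OF that(1)] that by blast
  have prev: "estimates m (L2 m (n - 1) J X) (card (defective m (n - 2) X J))"
    if "3 \<le> n" "J \<subseteq> column m (n - 1)" "X \<subseteq> column m (n - 2)" "X \<inter> prev_col m (n - 1) J \<noteq> {}" for J X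
    using less[of "n - 1"] that by (simp add: numeral_2_eq_2)
  have L2: "estimates m (L2 m n S T) (card (defective m (n - 1) T S))"
    if "2 \<le> n" "S \<subseteq> column m n" "T \<subseteq> column m (n - 1)" "T \<inter> prev_col m n S \<noteq> {}" for S T
    using L2_estimates_step[OF that L1 prev] by blast
  show ?case
  proof (intro conjI impI allI)
    fix S assume S: "1 \<le> n" "S \<noteq> {}" "S \<subseteq> column m n"
    show "estimates m (L1 m n S) (card (defective m n S {}))"
      by (rule L1_estimates_step[OF S L2]) (use S in auto)
  qed (rule L2)
qed

lemma N_low_estimates:
  assumes "1 \<le> n"
  shows "estimates m (N_low m n) (card (full_sets' m n))"
proof -
  let ?I = "{S. S \<noteq> {} \<and> S \<subseteq> column m n}"
  have "finite ?I"
    by (rule finite_subset[of _ "Pow (column m n)"]) auto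
  moreover have "full_sets' m n = (\<Union>S\<in>?I. defective m n S {})"
    using assms by (auto simp: full_sets'_eq defective_def full_sets_iff)
  ultimately have "card (full_sets' m n) = (\<Sum>S\<in>?I. card (defective m n S {}))"
    by (simp only:) (rule card_UN_disjoint, auto simp: defective_def)
  then show ?thesis
    unfolding N_low_def using L_estimates[of n m] assms by (auto intro!: estimates_sum)
qed

section \<open>Translating connected sets along the columns\<close>

definition shift :: "nat \<Rightarrow> nat \<times> nat \<Rightarrow> nat \<times> nat" where
  "shift t v = (fst v, snd v + t)"

lemma inj_shift: "inj_on (shift t) A"
  by (rule inj_onI) (auto simp: shift_def prod_eq_iff)

lemma conn_image:
  assumes "conn r C" "\<And>u v. u \<in> C \<Longrightarrow> v \<in> C \<Longrightarrow> (u, v) \<in> r \<Longrightarrow> (f u, f v) \<in> s"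
  shows "conn s (f ` C)"
proof -
  have "(f u, f v) \<in> rtrancl_on (f ` C) s" if "(u, v) \<in> rtrancl_on C r" for u v
    using that
  proof (induct rule: rtrancl_on_induct)
    case (step y z)
    then show ?case using assms(2) by (blast intro: rtrancl_on_into_rtrancl_on)
  qed auto
  with assms(1) show ?thesis by (auto simp: conn_def)
qed

lemma conn_grid_shift_iff: "conn grid (shift t ` C) \<longleftrightarrow> conn grid C"
proof
  assume "conn grid (shift t ` C)"
  \<comment> \<open>Truncated subtraction is harmless here: every column in the image of
    \<open>shift t\<close> is at least \<open>t\<close>.\<close>
  then have "conn grid ((\<lambda>v. (fst v, snd v - t)) ` shift t ` C)"
    by (rule conn_image) (auto simp: shift_def grid_def)
  then show "conn grid C" by (simp add: image_image shift_def)
next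
  assume "conn grid C"
  then show "conn grid (shift t ` C)"
    by (rule conn_image) (auto simp: shift_def grid_def)
qed

lemma conn_mono_rel: "conn r C \<Longrightarrow> r \<subseteq> s \<Longrightarrow> conn s C"
  using conn_image[of r C id s] by auto

text \<open>Each step changes the column by at most one, so a connected set skips no column.\<close>

lemma conn_grid_columns:
  assumes "conn grid C" "u \<in> C" "v \<in> C" "snd u \<le> j" "j \<le> snd v"
  shows "\<exists>w\<in>C. snd w = j"
proof -
  have "snd z < j \<or> (\<exists>w\<in>C. snd w = j)" if "(u, z) \<in> rtrancl_on C grid" for z
    using that
  proof (induct rule: rtrancl_on_induct)
    case base
    then show ?case using assms(2,4) by fastforce
  next
    case (step y z)
    then have "snd z \<le> snd y + 1" by (auto simp: grid_def)
    then show ?case using step by fastforce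
  qed
  from this[of v] show ?thesis
    using assms by (auto simp: conn_def)
qed

lemma snd_full_sets:
  assumes "C \<in> full_sets m k" "1 \<le> k"
  shows "snd ` C = {1..k}"
  using assms full_sets_iff[of k C m] by (force simp: mem_box_iff mem_column_iff)

text \<open>A connected set of the grid occupies a block of consecutive columns. Moving the block to
  the left end yields a full set of \<open>k\<close> columns that is connected in the grid.\<close>

lemma connected_sets_PP_eq_UN_shift:
  "connected_sets (PP m n) = (\<Union>(k, t) \<in> (SIGMA k : {1..n}. {0..n - k}).
     (\<lambda>C. shift t ` C) ` (full_sets m k - full_sets' m k))" (is "_ = ?U")
proof (intro set_eqI iffI)
  fix C assume "C \<in> connected_sets (PP m n)"
  then have C: "C \<subseteq> box m n" "conn grid C" by (auto simp: connected_sets_PP)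
  have fin: "finite (snd ` C)" using C(1) finite_box finite_subset by blast
  have ne: "snd ` C \<noteq> {}" using C(2) by (auto simp: conn_def)
  define a b where "a = Min (snd ` C)" and "b = Max (snd ` C)"
  have ab: "a \<in> snd ` C" "b \<in> snd ` C" "\<And>v. v \<in> C \<Longrightarrow> a \<le> snd v \<and> snd v \<le> b"
    using fin ne by (auto simp: a_def b_def)
  have bounds: "1 \<le> a" "a \<le> b" "b \<le> n"
    using ab C(1) by (fastforce simp: mem_box_iff)+
  \<comment> \<open>\<open>k\<close> is the width of the block from \<open>a\<close> to
    \<open>b\<close>; \<open>t\<close> is the number of columns to its left, so that column
    \<open>a\<close> is sent to column 1.\<close>
  define k t where "k = b - a + 1" and "t = a - 1"
  define C' where "C' = (\<lambda>v. (fst v, snd v - t)) ` C"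
  have shift: "shift t ` C' = C"
    unfolding C'_def image_image shift_def
  proof -
    have "(fst (fst x, snd x - t), snd (fst x, snd x - t) + t) = x" if "x \<in> C" for x
      using ab(3)[OF that] by (auto simp: t_def prod_eq_iff)
    then show "(\<lambda>x. (fst (fst x, snd x - t), snd (fst x, snd x - t) + t)) ` C = C" by force
  qed
  have conn: "conn grid C'"
    using conn_grid_shift_iff[of t C'] C(2) by (simp only: shift)
  have "C' \<subseteq> box m k"
    using C(1) ab(3) bounds by (fastforce simp: C'_def mem_box_iff k_def t_def)
  moreover have "C' \<inter> column m j \<noteq> {}" if j: "j \<in> {1..k}" for j
  proof -
    obtain u v where uv: "u \<in> C" "snd u = a" "v \<in> C" "snd v = b" using ab(1,2) by auto
    have "\<exists>w\<in>C. snd w = j + t"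
      using conn_grid_columns[OF C(2) uv(1,3), of "j + t"] uv j bounds by (auto simp: k_def t_def)
    then obtain w where w: "w \<in> C" "snd w = j + t" by blast
    then have "(fst w, j) \<in> C'" by (force simp: C'_def)
    moreover have "(fst w, j) \<in> column m j"
      using subsetD[OF C(1) w(1)] by (simp add: mem_column_iff mem_box_iff)
    ultimately show ?thesis by blast
  qed
  moreover have "conn complete_grid C'"
    by (rule conn_mono_rel[OF conn]) (auto simp: grid_def complete_grid_def)
  ultimately have "C' \<in> full_sets m k - full_sets' m k"
    using conn by (auto simp: full_sets'_eq full_sets_def connected_sets_KP)
  moreover have "(k, t) \<in> (SIGMA k : {1..n}. {0..n - k})"
    using bounds by (auto simp: k_def t_def)
  ultimately show "C \<in> ?U" using shift by blast
next
  fix C assume "C \<in> ?U"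
  then obtain k t C' where kt: "1 \<le> k" "k \<le> n" "t \<le> n - k"
    and C': "C' \<in> full_sets m k" "C' \<notin> full_sets' m k" and C: "C = shift t ` C'"
    by auto
  have "conn grid C" using C' by (simp add: full_sets'_eq C conn_grid_shift_iff)
  moreover have "C \<subseteq> box m n"
    using full_sets_subset[OF C'(1)] kt by (fastforce simp: C shift_def mem_box_iff)
  ultimately show "C \<in> connected_sets (PP m n)" by (simp add: connected_sets_PP)
qed

lemma num_connected_sets_PP:
  "num_connected_sets (PP m n) = (\<Sum>k = 1..n. card (full_sets m k - full_sets' m k) * (n - k + 1))"
proof -
  let ?I = "SIGMA k : {1..n}. {0..n - k}"
  let ?F = "\<lambda>(k, t). (\<lambda>C. shift t ` C) ` (full_sets m k - full_sets' m k)"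
  \<comment> \<open>The set of occupied columns determines \<open>k\<close> and \<open>t\<close>, so
    the pieces of the union are disjoint. For each \<open>k\<close> there are
    \<open>n - k + 1\<close> positions, which is the weight in the sum.\<close>
  have snd_shift: "snd ` D = {t + 1..t + k}" if kt: "(k, t) \<in> ?I" and D: "D \<in> ?F (k, t)" for k t D
  proof -
    obtain C where C: "C \<in> full_sets m k" "D = shift t ` C" using D by blast
    then have "snd ` D = (\<lambda>j. j + t) ` snd ` C" by (auto simp: shift_def image_image)
    also have "snd ` C = {1..k}" using snd_full_sets[OF C(1)] kt by auto
    also have "(\<lambda>j. j + t) ` {1..k} = {t + 1..t + k}" by (simp add: add.commute)
    finally show ?thesis .
  qed
  have "?F p \<inter> ?F q = {}" if pq: "p \<in> ?I" "q \<in> ?I" "p \<noteq> q" for p q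
  proof (rule ccontr)
    assume "?F p \<inter> ?F q \<noteq> {}"
    then obtain D where D: "D \<in> ?F p" "D \<in> ?F q" by blast
    obtain k t k' t' where kt: "p = (k, t)" "q = (k', t')" by (cases p; cases q)
    then have "{t + 1..t + k} = {t' + 1..t' + k'}" and "1 \<le> k" "1 \<le> k'"
      using snd_shift[of k t D] snd_shift[of k' t' D] D pq by auto
    then show False using pq(3) kt by (auto simp: Icc_eq_Icc)
  qed
  then have "card (\<Union>p\<in>?I. ?F p) = (\<Sum>p\<in>?I. card (?F p))"
    by (intro card_UN_disjoint) auto
  also have "\<dots> = (\<Sum>(k, t)\<in>?I. card (full_sets m k - full_sets' m k))"
  proof (rule sum.cong[OF refl], clarify)
    fix k t
    have "inj_on (\<lambda>C. shift t ` C) (full_sets m k - full_sets' m k)"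
      by (rule inj_onI) (metis inj_image_eq_iff inj_shift)
    then show "card ((\<lambda>C. shift t ` C) ` (full_sets m k - full_sets' m k)) = card (full_sets m k - full_sets' m k)"
      by (rule card_image)
  qed
  also have "\<dots> = (\<Sum>k = 1..n. \<Sum>t = 0..n - k. card (full_sets m k - full_sets' m k))"
    by (subst sum.Sigma) auto
  also have "\<dots> = (\<Sum>k = 1..n. card (full_sets m k - full_sets' m k) * (n - k + 1))"
    by (intro sum.cong) auto
  finally show ?thesis
    by (simp add: num_connected_sets_def connected_sets_PP_eq_UN_shift)
qed

theorem theorem3p3:
  fixes m n :: nat
  assumes "m \<ge> 1" and "n \<ge> 1"
  shows "int (num_connected_sets (PP m n))
             \<le> (\<Sum>k = 1..n. (int (N_full m k) - int (N_low m k)) * (int n - int k + 1))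
         \<and> (m = 3 \<or> m = 4 \<longrightarrow>
             int (num_connected_sets (PP m n))
               = (\<Sum>k = 1..n. (int (N_full m k) - int (N_low m k)) * (int n - int k + 1)))"
proof -
  have sub: "full_sets' m k \<subseteq> full_sets m k" for k
    by (auto simp: full_sets'_eq)
  have diff: "int (card (full_sets m k - full_sets' m k)) = int (N_full m k) - int (card (full_sets' m k))" for k
    unfolding N_full_def card_Diff_subset[OF finite_subset[OF sub finite_full_sets] sub]
    by (rule of_nat_diff) (simp add: card_mono sub)
  have count: "int (num_connected_sets (PP m n))
      = (\<Sum>k = 1..n. (int (N_full m k) - int (card (full_sets' m k))) * (int n - int k + 1))"
    unfolding num_connected_sets_PP of_nat_sum of_nat_mult diff
    by (intro sum.cong) (auto simp: of_nat_diff)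
  have est: "estimates m (N_low m k) (card (full_sets' m k))" if "k \<in> {1..n}" for k
    using N_low_estimates that by simp
  \<comment> \<open>The weights are nonnegative for \<open>k \<le> n\<close>, so putting the lower
    bound \<open>N_low\<close> in place of the exact count can only enlarge each summand, and
    changes nothing when \<open>m\<close> is 3 or 4.\<close>
  show ?thesis
    unfolding count
    using est by (auto simp: estimates_def intro!: sum_mono mult_right_mono sum.cong)
qed

end
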